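(* Let $q$ be a positive power of a prime $p$, let $P(t)\in\mathbb{F}_q[t]$ be an irreducible polynomial of degree $d\ge 1$, and let $\Theta(t)=\sum_{i=1}^\infty a_i t^{-i}\in\mathbb{F}_q((t^{-1}))$ (with $a_i\in\mathbb{F}_q$) be an element of $\mathbf{Bad}(t,q)$. Define $\Phi(t):=\sum_{i=1}^\infty a_i P(t)^{-i}\in\mathbb{F}_q((t^{-1}))$ (so that $\Phi(t)\in\mathbf{Bad}(P(t),q)$). Then the two-dimensional hybrid sequence $\mathbf{H}(\Phi,P)=(\mathbf{H}_n)_{n\ge 0}$, $\mathbf{H}_n:=\left(K_n(\Phi),V_n(P)\right)\in[0,1)^2$, is low discrepancy, i.e. there is a constant $C>0$ depending only on $\Theta$, $P$ (and $q$) such that for all $N\ge 2$, \[D_N(\mathbf{H})\le C\,\frac{\log^2 N}{N}.\]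
   Context: Finite field: $q=p^n$; if $n>1$, $\mathbb{F}_q=\mathbb{F}_p[x]/(p(x))$ for a fixed irreducible $p(x)\in\mathbb{F}_p[x]$ of degree $n$, and each element of $\mathbb{F}_q$ is identified with its unique representative $f(x)\in\mathbb{F}_p[x]$ of degree $<n$ (for $n=1$, elements are residues $0,\dots,p-1$). The evaluation function $E_q:\mathbb{F}_q\to\{0,1,\dots,q-1\}$ is $E_q(f(x))=f(p)$ (a bijection). For a Laurent series $\Psi(t)=\sum_{i\ge -h} f_i t^{-i}\in\mathbb{F}_q((t^{-1}))$ define $ev_q(\Psi)=\sum_{i\ge -h}E_q(f_i)q^{-i}\in\mathbb{R}$. Degree and norm: if $\Psi=\sum_{i\ge -h}f_it^{-i}$ with $f_{-h}\ne 0$, then $\deg\Psi=h$ and $|\Psi|=q^{h}$ ($|0|=0$); the fractional part is $\langle\Psi\rangle=\sum_{i\ge 1}f_it^{-i}$. For a polynomial $Q(t)\in\mathbb{F}_q[t]$ irreducible, $\mathbf{Bad}(Q(t),q)$ is the set of $\Psi\in\mathbb{F}_q((t^{-1}))$ such that $\inf\{|N(t)|\cdot|\langle N(t)Q(t)^k\Psi(t)\rangle| : N(t)\in\mathbb{F}_q[t]\setminus\{0\},\ k\ge 0\}>0$; $\mathbf{Bad}(t,q)$ is this set for $Q(t)=t$. For $n\in\mathbb{N}$ with base-$q$ expansion $n=\sum_i c_iq^i$ ($0\le c_i<q$), its associated polynomial is $n(t)=\sum_i E_q^{-1}(c_i)t^i\in\mathbb{F}_q[t]$. Digital Van der Corput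 sequence: write $n(t)=\sum_{i\ge0} b_i(t)P(t)^i$ with $b_i\in\mathbb{F}_q[t]$, $\deg b_i<d$ (finitely many nonzero); then $V_n(P)=\sum_{i\ge 0} ev_q(b_i(t))\,|P(t)|^{-(i+1)}=\sum_{i\ge0}ev_q(b_i(t))q^{-d(i+1)}$. Digital Kronecker sequence: $K_n(\Phi)=ev_q\left(\langle n(t)\Phi(t)\rangle\right)$. Discrepancy: for a sequence $(\mathbf{z}_n)_{n\ge0}$ in $[0,1)^2$ and $N\ge1$, $D_N(\mathbf{z})=\sup_{\mathcal{B}}\left|\frac{\#\{0\le n<N:\mathbf{z}_n\in\mathcal{B}\}}{N}-\mu_2(\mathcal{B})\right|$, supremum over axis-parallel boxes $\mathcal{B}\subset[0,1)^2$, with $\mu_2$ Lebesgue measure. *)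

theory Defs
  imports
    "Berlekamp_Zassenhaus.Finite_Field"
    "HOL-Analysis.Analysis"
    "HOL-Computational_Algebra.Computational_Algebra"
begin

section \<open>The finite field and its evaluation function\<close>

text \<open>
  The field of order \<open>q = p ^ n\<close> is \<open>F_p[x]/(m(x))\<close> with \<open>m\<close> irreducible of degree \<open>n\<close>. Here
  \<open>F_p\<close> is the type \<open>'p mod_ring\<close> with \<open>p = CARD('p)\<close>, and the quotient is a field \<open>'f\<close>
  with a surjective ring homomorphism \<open>\<phi>\<close> from \<open>F_p[x]\<close> whose kernel is the ideal generated by
  \<open>m\<close>; thus \<open>q = CARD('f)\<close>. For \<open>n = 1\<close> the polynomials of degree \<open>< n\<close> are the constants
  \<open>0, \<dots>, p - 1\<close>, whatever \<open>m\<close> is, so this case needs no separate treatment.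
\<close>

definition Fq_quotient ::
  "'p::prime_card mod_ring poly \<Rightarrow> ('p mod_ring poly \<Rightarrow> 'f::{finite,field}) \<Rightarrow> bool" where
  "Fq_quotient m \<phi> \<longleftrightarrow>
     irreducible m \<and> comm_ring_hom \<phi> \<and> surj \<phi> \<and> (\<forall>f. \<phi> f = 0 \<longleftrightarrow> m dvd f)"

definition Fq_rep ::
  "'p::prime_card mod_ring poly \<Rightarrow> ('p mod_ring poly \<Rightarrow> 'f::{finite,field}) \<Rightarrow> 'f
     \<Rightarrow> 'p mod_ring poly" where
  "Fq_rep m \<phi> c = (THE f. degree f < degree m \<and> \<phi> f = c)"

definition Fq_eval ::
  "'p::prime_card mod_ring poly \<Rightarrow> ('p mod_ring poly \<Rightarrow> 'f::{finite,field}) \<Rightarrow> 'f \<Rightarrow> nat" where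
  "Fq_eval m \<phi> c = nat (poly (map_poly to_int_mod_ring (Fq_rep m \<phi> c)) (int CARD('p)))"

section \<open>Laurent series in the inverse of \<open>t\<close>\<close>

text \<open>
  The library's \<open>'f fls\<close> is the field of Laurent series in its variable \<open>fls_X\<close>, which here
  plays the role of \<open>t\<^sup>-\<^sup>1\<close>: the coefficient of \<open>t\<close> to the power \<open>- i\<close> in \<open>\<Psi>\<close> is \<open>fls_nth \<Psi> i\<close>, and
  \<open>deg \<Psi> = - fls_subdegree \<Psi>\<close>. Infinite sums of Laurent series refer to the library's metric
  on \<open>'f fls\<close>, i.e. to the \<open>fls_X\<close>-adic topology.
\<close>

abbreviation laurent_t :: "'f::field fls" where
  "laurent_t \<equiv> fls_X_inv"

definition laurent_of_poly :: "'f::field poly \<Rightarrow> 'f fls" where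
  "laurent_of_poly N = poly (map_poly fls_const N) laurent_t"

definition laurent_norm :: "'f::{finite,field} fls \<Rightarrow> real" where
  "laurent_norm \<Psi> = (if \<Psi> = 0 then 0 else real CARD('f) powi (- fls_subdegree \<Psi>))"

definition laurent_frac :: "'f::field fls \<Rightarrow> 'f fls" where
  "laurent_frac \<Psi> = fps_to_fls (Abs_fps (\<lambda>i. if i = 0 then 0 else fls_nth \<Psi> (int i)))"

text \<open>The parameter \<open>E\<close> below is the evaluation function \<open>E_q\<close> of the field.\<close>

definition laurent_eval :: "('f::{finite,field} \<Rightarrow> nat) \<Rightarrow> 'f fls \<Rightarrow> real" where
  "laurent_eval E \<Psi> =
     (\<Sum>\<^sub>\<infinity>i\<in>{fls_subdegree \<Psi>..}. real (E (fls_nth \<Psi> i)) * real CARD('f) powi (- i))"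

definition Bad :: "'f::{finite,field} poly \<Rightarrow> 'f fls set" where
  "Bad Q = {\<Psi>. Inf {laurent_norm (laurent_of_poly N)
                       * laurent_norm (laurent_frac (laurent_of_poly (N * Q ^ k) * \<Psi>)) | N k.
                     N \<noteq> 0} > 0}"

section \<open>Digital sequences\<close>

definition assoc_poly :: "('f::{finite,field} \<Rightarrow> nat) \<Rightarrow> nat \<Rightarrow> 'f poly" where
  "assoc_poly E n = (\<Sum>i\<le>n. monom (inv_into UNIV E (n div CARD('f) ^ i mod CARD('f))) i)"

text \<open>
  The \<open>i\<close>-th digit \<open>b\<^sub>i\<close> of \<open>A = (\<Sum>i. b\<^sub>i * P ^ i)\<close> with \<open>degree b\<^sub>i < degree P\<close>
  (see \<open>poly_digit_expansion\<close> below).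
\<close>

definition poly_digit :: "'f::field poly \<Rightarrow> 'f poly \<Rightarrow> nat \<Rightarrow> 'f poly" where
  "poly_digit P A i = A div P ^ i mod P"

lemma poly_digit_expansion:
  fixes P A :: "'f::field poly"
  assumes "degree P \<ge> 1"
  shows "A = (\<Sum>i\<le>degree A. poly_digit P A i * P ^ i)"
    and "degree (poly_digit P A i) < degree P"
proof -
  have *: "A = (\<Sum>i<k. poly_digit P A i * P ^ i) + A div P ^ k * P ^ k" for k
  proof (induction k)
    case (Suc k)
    have "A div P ^ k = poly_digit P A k + A div P ^ k div P * P"
      by (simp add: poly_digit_def)
    moreover have "A div P ^ k div P = A div P ^ Suc k"
      by (simp add: poly_div_mult_right power_Suc2 del: power_Suc)
    ultimately have "A div P ^ k * P ^ k = poly_digit P A k * P ^ k + A div P ^ Suc k * P ^ Suc k"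
      by (metis distrib_right mult.assoc power_Suc)
    with Suc show ?case by (simp add: add.assoc)
  qed simp
  have "P \<noteq> 0" using assms by auto
  then have "degree (P ^ Suc (degree A)) = Suc (degree A) * degree P"
    by (simp add: degree_power_eq del: power_Suc)
  moreover have "Suc (degree A) * 1 \<le> Suc (degree A) * degree P"
    using assms by (intro mult_le_mono) auto
  ultimately have "A div P ^ Suc (degree A) = 0"
    by (intro div_poly_less) (metis Suc_le_lessD mult.right_neutral)
  with *[of "Suc (degree A)"] show "A = (\<Sum>i\<le>degree A. poly_digit P A i * P ^ i)"
    by (simp add: lessThan_Suc_atMost)
  show "degree (poly_digit P A i) < degree P"
    using degree_mod_less[of P "A div P ^ i"] \<open>P \<noteq> 0\<close> assms by (auto simp: poly_digit_def)
qed

definition van_der_corput ::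
  "('f::{finite,field} \<Rightarrow> nat) \<Rightarrow> 'f poly \<Rightarrow> nat \<Rightarrow> real" where
  "van_der_corput E P n =
     (\<Sum>i. laurent_eval E (laurent_of_poly (poly_digit P (assoc_poly E n) i))
            / laurent_norm (laurent_of_poly P) ^ (i + 1))"

definition kronecker :: "('f::{finite,field} \<Rightarrow> nat) \<Rightarrow> 'f fls \<Rightarrow> nat \<Rightarrow> real" where
  "kronecker E \<Phi> n = laurent_eval E (laurent_frac (laurent_of_poly (assoc_poly E n) * \<Phi>))"

definition hybrid ::
  "('f::{finite,field} \<Rightarrow> nat) \<Rightarrow> 'f fls \<Rightarrow> 'f poly \<Rightarrow> nat \<Rightarrow> real \<times> real" where
  "hybrid E \<Phi> P n = (kronecker E \<Phi> n, van_der_corput E P n)"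

text \<open>The intervals \<open>I\<close> and \<open>J\<close> may be open, closed or half-open.\<close>

definition boxes :: "(real \<times> real) set set" where
  "boxes = {I \<times> J | I J. is_interval I \<and> is_interval J \<and> I \<subseteq> {0..<1} \<and> J \<subseteq> {0..<1}}"

definition discrepancy :: "(nat \<Rightarrow> real \<times> real) \<Rightarrow> nat \<Rightarrow> real" where
  "discrepancy z N =
     (SUP B\<in>boxes. \<bar>real (card {n. n < N \<and> z n \<in> B}) / real N - measure lborel B\<bar>)"

end

theory Submission
  imports Defs
begin

text \<open>
  Put \<open>b = q\<^sup>d\<close> and write \<open>n(t) = \<Sum>j. b\<^sub>j P\<^sup>j\<close>. Since \<open>P\<^sup>j \<Phi>\<close> is, up to a polynomial,
  \<open>\<Sum>l\<ge>1. a\<^sub>l\<^sub>+\<^sub>j P\<^sup>-\<^sup>l\<close>, the fractional part of \<open>n(t) \<Phi>\<close> has \<open>P\<close>-adic digits \<open>\<Sum>j. a\<^sub>l\<^sub>+\<^sub>j b\<^sub>j\<close>: coefficient by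
  coefficient in \<open>t\<close>, the Hankel matrix of \<open>\<Theta>\<close> is applied to the digits of \<open>n(t)\<close>. Badness of \<open>\<Theta>\<close> says
  that the Hankel blocks with \<open>c\<close> more rows than columns have full column rank, which yields
  \<open>\<Phi> \<in> Bad P\<close>; transposed, the blocks with \<open>c\<close> more columns than rows have full row rank. Hence in a block
  \<open>s b\<^sup>J \<le> n < (s + 1) b\<^sup>J\<close> prescribing the first \<open>k\<close> base-\<open>b\<close> digits of \<open>V\<^sub>n\<close> and the first \<open>L\<close> ones of
  \<open>K\<^sub>n\<close>, where \<open>k + L + c = J\<close>, leaves exactly \<open>b\<^sup>c\<close> values of \<open>n\<close>. Such a net has counting error \<open>O(J + 1)\<close>
  on every box, and \<open>[0, N)\<close> is a union of fewer than \<open>b\<close> blocks of each size \<open>b\<^sup>J \<le> N\<close>, which gives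
  \<open>O(log\<^sup>2 N)\<close>.
\<close>

section \<open>Digit expansions of numbers\<close>

text \<open>The first \<open>k\<close> digits read as an integer, most significant first: the index
  of a closed cell of length \<open>1 / \<beta> ^ k\<close> containing the number that has these
  digits after the point.\<close>

primrec prefix_value :: "nat \<Rightarrow> (nat \<Rightarrow> nat) \<Rightarrow> nat \<Rightarrow> nat" where
  "prefix_value \<beta> \<delta> 0 = 0"
| "prefix_value \<beta> \<delta> (Suc k) = \<beta> * prefix_value \<beta> \<delta> k + \<delta> k"

lemma prefix_value_less:
  assumes "\<And>i. \<delta> i < \<beta>"
  shows "prefix_value \<beta> \<delta> k < \<beta> ^ k"
proof (induction k)
  case (Suc k)
  have "\<beta> * prefix_value \<beta> \<delta> k + \<delta> k < \<beta> * Suc (prefix_value \<beta> \<delta> k)"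
    using assms[of k] by simp
  also have "\<dots> \<le> \<beta> * \<beta> ^ k"
    using Suc.IH by (intro mult_le_mono) auto
  finally show ?case by simp
qed simp

lemma prefix_value_div:
  assumes "\<And>i. \<delta> i < \<beta>"
  shows "prefix_value \<beta> \<delta> (Suc k) div \<beta> = prefix_value \<beta> \<delta> k"
  using assms[of k] by simp

lemma prefix_value_eqD:
  assumes "\<And>i. \<delta> i < \<beta>" "\<And>i. \<delta>' i < \<beta>"
    and "prefix_value \<beta> \<delta> k = prefix_value \<beta> \<delta>' k" "i < k"
  shows "\<delta> i = \<delta>' i"
  using assms(3,4)
proof (induction k)
  case (Suc k)
  have "prefix_value \<beta> \<delta> k = prefix_value \<beta> \<delta>' k"
    using arg_cong[OF Suc.prems(1), of "\<lambda>x. x div \<beta>"]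
    by (simp only: prefix_value_div[of \<delta>, OF assms(1)] prefix_value_div[of \<delta>', OF assms(2)])
  moreover from this have "\<delta> k = \<delta>' k"
    using Suc.prems(1) by simp
  ultimately show ?case
    using Suc.IH Suc.prems(2) by (auto simp: less_Suc_eq)
qed simp

text \<open>The partial sums are \<open>prefix_value \<beta> \<delta> n / \<beta> ^ n\<close> and
  never decrease, while the same quotients with 1 added to the numerator never increase
  (\<open>up\<close>). The value of the expansion is squeezed between the two.\<close>

lemma
  assumes d: "\<And>i. \<delta> i < \<beta>"
  shows prefix_value_summable: "summable (\<lambda>i. real (\<delta> i) / real \<beta> ^ (i + 1))" (is "summable ?f")
    and prefix_value_le: "real (prefix_value \<beta> \<delta> k) \<le> (\<Sum>i. real (\<delta> i) / real \<beta> ^ (i + 1)) * real \<beta> ^ k"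
    and prefix_value_ge: "(\<Sum>i. real (\<delta> i) / real \<beta> ^ (i + 1)) * real \<beta> ^ k \<le> real (prefix_value \<beta> \<delta> k) + 1"
proof -
  have pos: "\<beta> > 0" using d[of 0] by simp
  have psum: "(\<Sum>i<n. ?f i) = real (prefix_value \<beta> \<delta> n) / real \<beta> ^ n" for n
    using pos by (induction n) (simp_all add: add_divide_distrib)
  have up: "(real (prefix_value \<beta> \<delta> n) + 1) / real \<beta> ^ n \<le> (real (prefix_value \<beta> \<delta> k) + 1) / real \<beta> ^ k"
    if "k \<le> n" for n k
    using that
  proof (induction n rule: dec_induct)
    case (step n)
    have "real (\<beta> * prefix_value \<beta> \<delta> n + \<delta> n + 1) \<le> real (\<beta> * (prefix_value \<beta> \<delta> n + 1))"
      using d[of n] by (intro of_nat_mono) simp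
    then have "(real (prefix_value \<beta> \<delta> (Suc n)) + 1) / real \<beta> ^ Suc n
        \<le> real (\<beta> * (prefix_value \<beta> \<delta> n + 1)) / real \<beta> ^ Suc n"
      by (intro divide_right_mono) auto
    also have "\<dots> = (real (prefix_value \<beta> \<delta> n) + 1) / real \<beta> ^ n"
      using pos by (simp add: field_simps)
    finally show ?case using step.IH by simp
  qed simp
  have nonneg: "?f i \<ge> 0" for i by simp
  have bound: "(\<Sum>i<n. ?f i) \<le> (real (prefix_value \<beta> \<delta> k) + 1) / real \<beta> ^ k" if "k \<le> n" for n k
  proof -
    have "(\<Sum>i<n. ?f i) \<le> (real (prefix_value \<beta> \<delta> n) + 1) / real \<beta> ^ n"
      unfolding psum by (intro divide_right_mono) auto
    then show ?thesis using up[OF that] by linarith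
  qed
  have "(\<Sum>i<n. ?f i) \<le> 1" for n
    using bound[of 0 n] by simp
  then show summ: "summable ?f"
    by (intro bounded_imp_summable[where B=1] nonneg) (simp only: lessThan_Suc_atMost[symmetric])
  have "(\<Sum>i<k. ?f i) \<le> suminf ?f"
    by (intro sum_le_suminf summ) auto
  then show "real (prefix_value \<beta> \<delta> k) \<le> suminf ?f * real \<beta> ^ k"
    unfolding psum using pos by (simp only: pos_divide_le_eq zero_less_power of_nat_0_less_iff)
  have "suminf ?f \<le> (real (prefix_value \<beta> \<delta> k) + 1) / real \<beta> ^ k"
    by (rule LIMSEQ_le_const2[OF summable_LIMSEQ[OF summ]]) (use bound[of k] in blast)
  then show "suminf ?f * real \<beta> ^ k \<le> real (prefix_value \<beta> \<delta> k) + 1"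
    using pos by (simp add: field_simps)
qed

lemma prefix_value_eq_sum: "prefix_value \<beta> \<delta> n = (\<Sum>i<n. \<delta> i * \<beta> ^ (n - Suc i))"
proof (induction n)
  case (Suc n)
  have "\<beta> * (\<Sum>i<n. \<delta> i * \<beta> ^ (n - Suc i)) = (\<Sum>i<n. \<delta> i * \<beta> ^ (n - i))"
    unfolding sum_distrib_left
  proof (intro sum.cong refl)
    fix i assume "i \<in> {..<n}"
    then have "n - i = Suc (n - Suc i)" by auto
    then show "\<beta> * (\<delta> i * \<beta> ^ (n - Suc i)) = \<delta> i * \<beta> ^ (n - i)" by simp
  qed
  then show ?case using Suc.IH by simp
qed simp

text \<open>Reversing the digits carries the facts on prefixes over to expansions with the least
  significant digit first.\<close>

lemma digit_sum_eq_prefix_value: "(\<Sum>i<n. \<delta> i * \<beta> ^ i) = prefix_value \<beta> (\<lambda>i. \<delta> (n - Suc i)) n"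
  unfolding prefix_value_eq_sum using sum.nat_diff_reindex[of "\<lambda>i. \<delta> i * \<beta> ^ i" n] by simp

lemma digit_sum_less:
  fixes \<delta> :: "nat \<Rightarrow> nat"
  assumes "\<And>i. \<delta> i < \<beta>"
  shows "(\<Sum>i<n. \<delta> i * \<beta> ^ i) < \<beta> ^ n"
  unfolding digit_sum_eq_prefix_value using assms by (intro prefix_value_less)

lemma digit_sum_eqD:
  fixes \<delta> \<delta>' :: "nat \<Rightarrow> nat"
  assumes "\<And>i. \<delta> i < \<beta>" "\<And>i. \<delta>' i < \<beta>"
    and "(\<Sum>i<n. \<delta> i * \<beta> ^ i) = (\<Sum>i<n. \<delta>' i * \<beta> ^ i)" "i < n"
  shows "\<delta> i = \<delta>' i"
  using prefix_value_eqD[of "\<lambda>i. \<delta> (n - Suc i)" \<beta> "\<lambda>i. \<delta>' (n - Suc i)" n "n - Suc i"] assms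
  by (simp add: digit_sum_eq_prefix_value)

text \<open>Equal digits give equal residues modulo every \<open>b ^ k\<close>, and
  \<open>b ^ (x + y)\<close> exceeds both numbers.\<close>

lemma nat_eq_of_digits_eq:
  fixes x y :: nat
  assumes "b \<ge> 2" "\<And>i. x div b ^ i mod b = y div b ^ i mod b"
  shows "x = y"
proof -
  have *: "x mod b ^ k = y mod b ^ k" for k
  proof (induction k)
    case (Suc k)
    have "z mod b ^ Suc k = b ^ k * (z div b ^ k mod b) + z mod b ^ k" for z
      by (simp only: power_Suc2 mod_mult2_eq)
    then show ?case using Suc.IH assms(2)[of k] by simp
  qed simp
  have lt: "z < b ^ z" for z
    using less_exp[of z] power_mono[of 2 b z] assms(1) by linarith
  have "b ^ x \<le> b ^ (x + y)" "b ^ y \<le> b ^ (x + y)" using assms(1) by (auto intro!: power_increasing)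
  then have "x < b ^ (x + y)" "y < b ^ (x + y)" using lt[of x] lt[of y] by linarith+
  then show ?thesis using *[of "x + y"] by simp
qed

section \<open>Discrepancy of nets\<close>

text \<open>Whichever end points belong to \<open>I\<close>, it lies between the open and the closed
  interval with the same ends, and these have equal measure.\<close>

lemma interval_measure_Inf_Sup:
  fixes I :: "real set"
  assumes "is_interval I" "I \<noteq> {}" "I \<subseteq> {0..<1}"
  shows "{Inf I<..<Sup I} \<subseteq> I" "I \<subseteq> {Inf I..Sup I}" "measure lborel I = Sup I - Inf I"
    "Inf I \<le> Sup I"
proof -
  have bdd: "bdd_below I" "bdd_above I"
    using assms(3) by (auto intro!: bdd_belowI[of _ 0] bdd_aboveI[of _ 1])
  show 1: "{Inf I<..<Sup I} \<subseteq> I"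
  proof
    fix x assume "x \<in> {Inf I<..<Sup I}"
    then obtain y z where "y \<in> I" "y < x" "z \<in> I" "x < z"
      using cInf_less_iff[OF assms(2) bdd(1)] less_cSup_iff[OF assms(2) bdd(2)] by auto
    then show "x \<in> I"
      using assms(1) unfolding is_interval_1 by (meson less_imp_le)
  qed
  show 2: "I \<subseteq> {Inf I..Sup I}"
    using bdd by (auto intro: cInf_lower cSup_upper)
  then show le: "Inf I \<le> Sup I" using assms(2) by auto
  have [measurable]: "I \<in> sets borel"
    using assms(1) by (rule real_interval_borel_measurable)
  have "emeasure lborel {Inf I<..<Sup I} \<le> emeasure lborel I"
       "emeasure lborel I \<le> emeasure lborel {Inf I..Sup I}"
    using 1 2 by (auto intro!: emeasure_mono)
  then have "emeasure lborel I = ennreal (Sup I - Inf I)"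
    using le by (simp add: antisym)
  then show "measure lborel I = Sup I - Inf I"
    using le by (simp add: measure_def)
qed

lemma interval_measure_le_1:
  fixes I :: "real set"
  assumes "is_interval I" "I \<subseteq> {0..<1}"
  shows "measure lborel I \<le> 1"
proof (cases "I = {}")
  case False
  have "Inf I \<ge> 0" "Sup I \<le> 1"
    using False assms(2) by (auto intro!: cInf_greatest cSup_least)
  then show ?thesis using interval_measure_Inf_Sup(3)[OF assms(1) False assms(2)] by simp
qed simp

text \<open>The cells from \<alpha> to \<beta> approximate the interval from inside, those from
  \<alpha>' to \<beta>' from outside. A point is only known to lie in a closed cell, so the inner
  range avoids cells that touch an end of the interval and the outer range includes them.\<close>

lemma interval_cells:
  fixes I :: "real set" and B :: nat
  assumes "is_interval I" "I \<subseteq> {0..<1}" "B > 0"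
  obtains \<alpha> \<beta> \<alpha>' \<beta>' :: nat where
    "\<alpha> \<le> \<beta>" "\<beta> \<le> B" "\<alpha>' \<le> \<beta>'" "\<beta>' \<le> B"
    "\<And>X (z::real). real X \<le> z * B \<Longrightarrow> z * B \<le> real X + 1 \<Longrightarrow> \<alpha> \<le> X \<Longrightarrow> X < \<beta> \<Longrightarrow> z \<in> I"
    "\<And>X (z::real). X < B \<Longrightarrow> real X \<le> z * B \<Longrightarrow> z * B \<le> real X + 1 \<Longrightarrow> z \<in> I \<Longrightarrow> \<alpha>' \<le> X \<and> X < \<beta>'"
    "B * measure lborel I - 3 \<le> real \<beta> - real \<alpha>"
    "real \<beta>' - real \<alpha>' \<le> B * measure lborel I + 3"
proof (cases "I = {}")
  case True
  show ?thesis by (rule that[of 0 0 0 0]) (use True in auto)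
next
  case False
  define u v where "u = Inf I" and "v = Sup I"
  note I = interval_measure_Inf_Sup[OF assms(1) False assms(2), folded u_def v_def]
  have u0: "u \<ge> 0" and v1: "v \<le> 1"
    using False assms(2) by (auto simp: u_def v_def intro!: cInf_greatest cSup_least)
  obtain x where "x \<in> I" using False by blast
  then have u1: "u < 1" using I(2) assms(2) by fastforce
  \<comment> \<open>Inner cells start strictly to the right of \<open>u\<close> and end strictly to
    the left of \<open>v\<close>; \<open>max\<close> keeps their range well formed when no cell
    fits. For the outer cells \<open>nat\<close> cuts off the value -1 that occurs at
    \<open>u = 0\<close>, and \<open>min\<close> the cell \<open>B\<close> that occurs at
    \<open>v = 1\<close>. Either range misses the length by at most 2, which the constant 3
    covers.\<close>
  define \<alpha> \<beta> \<alpha>' \<beta>' where "\<alpha> = nat \<lfloor>u * B\<rfloor> + 1" and "\<beta> = max \<alpha> (nat (\<lceil>v * B\<rceil> - 1))"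
    and "\<alpha>' = nat (\<lceil>u * B\<rceil> - 1)" and "\<beta>' = min B (nat \<lfloor>v * B\<rfloor> + 1)"
  have uB: "u * B < B" "u * B \<ge> 0" "v * B \<le> B" "u * B \<le> v * B"
    using u0 u1 v1 assms(3) I(4) by (auto intro: mult_right_mono)
  have fl: "real (nat \<lfloor>u * B\<rfloor>) = of_int \<lfloor>u * B\<rfloor>" "real (nat \<lfloor>v * B\<rfloor>) = of_int \<lfloor>v * B\<rfloor>"
    using order_trans[OF uB(2,4)] uB(2) by (simp_all only: of_nat_nat zero_le_floor)
  have \<alpha>1: "real \<alpha> = of_int \<lfloor>u * B\<rfloor> + 1"
    using fl by (simp add: \<alpha>_def)
  have \<alpha>: "real \<alpha> > u * B" "real \<alpha> \<le> u * B + 1"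
    unfolding \<alpha>1 by linarith+
  have "real \<alpha> < real B + 1" using \<alpha>(2) uB(1) by linarith
  then have \<alpha>B: "\<alpha> \<le> B" by linarith
  have "\<lceil>v * B\<rceil> \<le> int B" using uB(3) by (simp add: ceiling_le_iff)
  then have \<beta>B: "\<beta> \<le> B" using \<alpha>B by (simp add: \<beta>_def)
  have ceil: "of_int \<lceil>x\<rceil> - 1 \<le> real (nat (\<lceil>x\<rceil> - 1))" for x :: real by simp
  have "real \<beta> \<ge> real (nat (\<lceil>v * B\<rceil> - 1))" by (simp add: \<beta>_def)
  then have \<beta>: "real \<beta> \<ge> v * B - 1"
    using ceil[of "v * B"] le_of_int_ceiling[of "v * B"] by linarith
  have \<alpha>': "real \<alpha>' \<ge> u * B - 1"
    using ceil[of "u * B"] le_of_int_ceiling[of "u * B"] unfolding \<alpha>'_def by linarith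
  have \<beta>': "real \<beta>' \<le> v * B + 1"
  proof -
    have "real \<beta>' \<le> real (nat \<lfloor>v * B\<rfloor>) + 1" by (simp add: \<beta>'_def min_def)
    then show ?thesis using fl(2) of_int_floor_le[of "v * B"] by linarith
  qed
  have \<alpha>'_le: "\<alpha>' \<le> X" if "u * B \<le> real X + 1" for X
  proof -
    have "\<lceil>u * B\<rceil> \<le> int X + 1" using that by (simp add: ceiling_le_iff)
    then show ?thesis by (simp add: \<alpha>'_def)
  qed
  have \<beta>'_gt: "X < \<beta>'" if "real X \<le> v * B" "X < B" for X
  proof -
    have "int X \<le> \<lfloor>v * B\<rfloor>" using that by (simp add: le_floor_iff)
    then show ?thesis using that by (simp add: \<beta>'_def)
  qed
  have \<alpha>'B: "\<alpha>' \<le> B" using \<alpha>'_le[of B] uB by simp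
  have \<alpha>'v: "\<alpha>' \<le> nat \<lfloor>v * B\<rfloor> + 1"
  proof (rule \<alpha>'_le)
    have "v * B < of_int \<lfloor>v * B\<rfloor> + 1" by linarith
    then show "u * B \<le> real (nat \<lfloor>v * B\<rfloor> + 1) + 1" using fl(2) uB(4) by linarith
  qed
  show ?thesis
  proof (rule that[of \<alpha> \<beta> \<alpha>' \<beta>'])
    show "\<alpha> \<le> \<beta>" "\<beta> \<le> B" "\<beta>' \<le> B" using \<beta>B by (auto simp: \<beta>_def \<beta>'_def)
    show "\<alpha>' \<le> \<beta>'" using \<alpha>'v \<alpha>'B by (simp add: \<beta>'_def)
    have *: "B * measure lborel I = v * B - u * B" by (simp only: I(3)) (simp add: algebra_simps)
    show "B * measure lborel I - 3 \<le> real \<beta> - real \<alpha>"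
      unfolding * using \<alpha> \<beta> by linarith
    show "real \<beta>' - real \<alpha>' \<le> B * measure lborel I + 3"
      unfolding * using \<alpha>' \<beta>' by linarith
    fix X and z :: real assume X: "real X \<le> z * B" "z * B \<le> real X + 1"
    {
      assume "\<alpha> \<le> X" "X < \<beta>"
      then have "u * B < z * B" using \<alpha>(1) X by linarith
      moreover have "X < nat (\<lceil>v * B\<rceil> - 1)"
        using \<open>\<alpha> \<le> X\<close> \<open>X < \<beta>\<close> by (simp add: \<beta>_def less_max_iff_disj)
      then have "int X + 1 < \<lceil>v * B\<rceil>" by linarith
      then have "real X + 1 < v * B" by (simp add: less_ceiling_iff)
      then have "z * B < v * B" using X by linarith
      ultimately show "z \<in> I" using I(1) assms(3) by auto
    }
    {
      assume "X < B" "z \<in> I"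
      then have "u \<le> z" "z \<le> v" using I(2) by auto
      then have "u * B \<le> z * B" "z * B \<le> v * B" by (auto intro: mult_right_mono)
      then have "u * B \<le> real X + 1" "real X \<le> v * B" using X by auto
      then show "\<alpha>' \<le> X \<and> X < \<beta>'" using \<open>X < B\<close> \<alpha>'_le \<beta>'_gt by blast
    }
  qed
qed


text \<open>The average fibre size is \<open>k\<close>, so if no fibre is larger, none is smaller.
  This turns an upper bound for every cell of the net into an exact count.\<close>

lemma card_fibre_eq:
  fixes f :: "'a \<Rightarrow> 'b"
  assumes "finite S" "finite T" "f ` S \<subseteq> T" "card S = card T * k"
    and le: "\<And>y. y \<in> T \<Longrightarrow> card {x\<in>S. f x = y} \<le> k"
    and y: "y \<in> T"
  shows "card {x\<in>S. f x = y} = k"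
proof (rule antisym[OF le[OF y]])
  have "card T * k = (\<Sum>z\<in>T. card {x\<in>S. f x = z})"
    using card_eq_sum[of S] sum.group[OF assms(1-3), of "\<lambda>_. 1::nat"] assms(4) by simp
  also have "\<dots> = card {x\<in>S. f x = y} + (\<Sum>z\<in>T - {y}. card {x\<in>S. f x = z})"
    using sum.remove[OF assms(2) y] by simp
  also have "\<dots> \<le> card {x\<in>S. f x = y} + (card T - 1) * k"
    using sum_mono[of "T - {y}" "\<lambda>z. card {x\<in>S. f x = z}" "\<lambda>_. k"] le y assms(2) by simp
  finally have "card T * k \<le> card {x\<in>S. f x = y} + (card T - 1) * k" .
  moreover have "card T = Suc (card T - 1)"
    using y assms(2) card_gt_0_iff[of T] by auto
  then have "card T * k = k + (card T - 1) * k" by (metis mult_Suc)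
  ultimately show "k \<le> card {x\<in>S. f x = y}" by simp
qed

lemma card_fibre_range:
  assumes "finite S" "\<And>A. A < B \<Longrightarrow> card {x\<in>S. f x = A} = k" "\<alpha> \<le> \<beta>" "\<beta> \<le> (B::nat)"
  shows "card {x\<in>S. \<alpha> \<le> f x \<and> f x < \<beta>} = (\<beta> - \<alpha>) * k"
proof -
  have "{x\<in>S. \<alpha> \<le> f x \<and> f x < \<beta>} = (\<Union>A\<in>{\<alpha>..<\<beta>}. {x\<in>S. f x = A})" by auto
  also have "card \<dots> = (\<Sum>A\<in>{\<alpha>..<\<beta>}. card {x\<in>S. f x = A})"
    using assms(1) by (intro card_UN_disjoint) auto
  also have "\<dots> = (\<Sum>A\<in>{\<alpha>..<\<beta>}. k)"
    using assms(2,4) by (intro sum.cong) auto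
  finally show ?thesis by simp
qed

text \<open>
  The second coordinate is resolved exactly, level by level: passing from level \<open>k\<close> to \<open>k + 1\<close>
  splits off fewer than \<open>b\<close> cells, and in a cell of level \<open>k\<close> the first coordinate need only be
  resolved to level \<open>J - c - k\<close>, with bounded error. Points are only located in closed cells, because
  a digit expansion that ends in the digit \<open>q - 1\<close> repeated has its value at the right end point.
\<close>

lemma abs_diff_le:
  fixes x p e u v :: real
  assumes "u \<le> x" "x \<le> v" "p - e \<le> u" "v \<le> p + e"
  shows "\<bar>x - p\<bar> \<le> e"
  using assms by linarith

lemma net_discrepancy:
  fixes S :: "'a set" and K V :: "'a \<Rightarrow> real" and X Y :: "nat \<Rightarrow> 'a \<Rightarrow> nat"
  assumes fin: "finite S" and card: "card S = b ^ J" and b: "b \<ge> 1"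
    and X_less: "\<And>k x. X k x < b ^ k" and X_div: "\<And>k x. X (Suc k) x div b = X k x"
    and X_cell: "\<And>k x. real (X k x) \<le> V x * real b ^ k" "\<And>k x. V x * real b ^ k \<le> real (X k x) + 1"
    and Y_less: "\<And>k x. Y k x < b ^ k"
    and Y_cell: "\<And>k x. real (Y k x) \<le> K x * real b ^ k" "\<And>k x. K x * real b ^ k \<le> real (Y k x) + 1"
    and net: "\<And>k l A A'. k + l + c = J \<Longrightarrow> A < b ^ k \<Longrightarrow> A' < b ^ l \<Longrightarrow>
                card {x\<in>S. X k x = A \<and> Y l x = A'} = b ^ c"
    and I: "is_interval I" "I \<subseteq> {0..<1}" and I': "is_interval I'" "I' \<subseteq> {0..<1}"
  shows "\<bar>real (card {x\<in>S. K x \<in> I \<and> V x \<in> I'}) - real b ^ J * (measure lborel I * measure lborel I')\<bar>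
           \<le> 9 * real b ^ (c + 1) * real (J + 1)"
proof -
  define len len' where "len = measure lborel I" and "len' = measure lborel I'"
  have len: "0 \<le> len" "len \<le> 1" "0 \<le> len'" "len' \<le> 1"
    using interval_measure_le_1[OF I] interval_measure_le_1[OF I'] by (auto simp: len_def len'_def)
  have b1: "real b \<ge> 1" using b by simp
  show ?thesis
  proof (cases "c \<le> J")
    \<comment> \<open>For \<open>J < c\<close> no net property is available, but then even all
      \<open>b ^ J\<close> points together stay within the claimed error.\<close>
    case False
    have "card {x\<in>S. K x \<in> I \<and> V x \<in> I'} \<le> b ^ J"
      unfolding card[symmetric] by (intro card_mono fin) auto
    then have "real (card {x\<in>S. K x \<in> I \<and> V x \<in> I'}) \<le> real b ^ J"
      unfolding of_nat_power[symmetric] of_nat_le_iff .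
    moreover have "len * len' \<le> 1" "0 \<le> len * len'" using len by (auto intro: mult_le_one)
    then have "real b ^ J * (len * len') \<le> real b ^ J" "0 \<le> real b ^ J * (len * len')"
      by (auto intro: mult_left_le)
    ultimately have "\<bar>real (card {x\<in>S. K x \<in> I \<and> V x \<in> I'}) - real b ^ J * (len * len')\<bar> \<le> real b ^ J"
      by linarith
    also have "\<dots> \<le> real b ^ (c + 1) * 1"
      using False b1 unfolding mult_1_right by (intro power_increasing) auto
    also have "real b ^ (c + 1) * 1 \<le> real b ^ (c + 1) * (9 * real (J + 1))"
      using b1 by (intro mult_left_mono) auto
    also have "\<dots> = 9 * real b ^ (c + 1) * real (J + 1)" by simp
    finally show ?thesis unfolding len_def len'_def .
  next
    case True
    \<comment> \<open>The net property leaves \<open>M\<close> digits to be shared between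
      \<open>V\<close> and \<open>K\<close>. The constant \<open>C\<close> is the error in one cell
      of \<open>V\<close>: \<open>interval_cells\<close> is off by at most 3 cells, each holding
      \<open>b ^ c\<close> points.\<close>
    define M where "M = J - c"
    define C where "C = 3 * real b ^ c"
    have C0: "C \<ge> 0" by (simp add: C_def)
    have cell: "\<bar>real (card {x\<in>S. X k x = A \<and> K x \<in> I}) - real b ^ (J - k) * len\<bar> \<le> C"
      if "k \<le> M" "A < b ^ k" for k A
    proof -
      define L where "L = M - k"
      have kL: "k + L + c = J" using that True by (simp add: L_def M_def)
      have bL: "b ^ L > 0" using b by simp
      obtain \<alpha> \<beta> \<alpha>' \<beta>' where cells: "\<alpha> \<le> \<beta>" "\<beta> \<le> b ^ L" "\<alpha>' \<le> \<beta>'" "\<beta>' \<le> b ^ L"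
        "\<And>X (z::real). real X \<le> z * real (b ^ L) \<Longrightarrow> z * real (b ^ L) \<le> real X + 1 \<Longrightarrow> \<alpha> \<le> X \<Longrightarrow> X < \<beta> \<Longrightarrow> z \<in> I"
        "\<And>X (z::real). X < b ^ L \<Longrightarrow> real X \<le> z * real (b ^ L) \<Longrightarrow> z * real (b ^ L) \<le> real X + 1 \<Longrightarrow> z \<in> I \<Longrightarrow> \<alpha>' \<le> X \<and> X < \<beta>'"
        "real (b ^ L) * measure lborel I - 3 \<le> real \<beta> - real \<alpha>"
        "real \<beta>' - real \<alpha>' \<le> real (b ^ L) * measure lborel I + 3"
        using interval_cells[OF I bL] by blast
      let ?S = "{x\<in>S. X k x = A}"
      have fib: "card {x\<in>?S. Y L x = A'} = b ^ c" if "A' < b ^ L" for A'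
        using net[OF kL \<open>A < b ^ k\<close> that] by simp
      have rng: "card {x\<in>?S. \<alpha> \<le> Y L x \<and> Y L x < \<beta>} = (\<beta> - \<alpha>) * b ^ c"
        "card {x\<in>?S. \<alpha>' \<le> Y L x \<and> Y L x < \<beta>'} = (\<beta>' - \<alpha>') * b ^ c"
        using card_fibre_range[where S = ?S and f = "Y L", OF _ fib] fin cells(1-4) by simp_all
      have "{x\<in>?S. \<alpha> \<le> Y L x \<and> Y L x < \<beta>} \<subseteq> {x\<in>S. X k x = A \<and> K x \<in> I}"
        "{x\<in>S. X k x = A \<and> K x \<in> I} \<subseteq> {x\<in>?S. \<alpha>' \<le> Y L x \<and> Y L x < \<beta>'}"
        using cells(5)[OF Y_cell[where k = L, folded of_nat_power]]
          cells(6)[OF Y_less Y_cell[where k = L, folded of_nat_power]]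
        by auto
      then have "(\<beta> - \<alpha>) * b ^ c \<le> card {x\<in>S. X k x = A \<and> K x \<in> I}"
        "card {x\<in>S. X k x = A \<and> K x \<in> I} \<le> (\<beta>' - \<alpha>') * b ^ c"
        using fin unfolding rng[symmetric] by (auto intro!: card_mono)
      then have "real ((\<beta> - \<alpha>) * b ^ c) \<le> real (card {x\<in>S. X k x = A \<and> K x \<in> I})"
        "real (card {x\<in>S. X k x = A \<and> K x \<in> I}) \<le> real ((\<beta>' - \<alpha>') * b ^ c)"
        by (simp_all only: of_nat_le_iff)
      moreover have "real b ^ (J - k) = real b ^ L * real b ^ c"
      proof -
        have "J - k = L + c" using kL by linarith
        then show ?thesis by (simp add: power_add)
      qed
      then have "(real b ^ L * len - 3) * real b ^ c = real b ^ (J - k) * len - C"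
        "(real b ^ L * len + 3) * real b ^ c = real b ^ (J - k) * len + C"
        by (simp_all add: C_def algebra_simps)
      moreover have "(real b ^ L * len - 3) * real b ^ c \<le> real ((\<beta> - \<alpha>) * b ^ c)"
        using cells(1,7) by (simp add: len_def of_nat_diff mult_right_mono)
      moreover have "real ((\<beta>' - \<alpha>') * b ^ c) \<le> (real b ^ L * len + 3) * real b ^ c"
        using cells(3,8) by (simp add: len_def of_nat_diff mult_right_mono)
      ultimately show ?thesis by (intro abs_diff_le) simp_all
    qed
    \<comment> \<open>Points with \<open>V\<close> in an initial segment of cells are counted by
      splitting the last base-\<open>b\<close> digit off \<beta>. The multiple of \<open>b\<close>
      is an initial segment of the coarser level \<open>k\<close>; the fewer than \<open>b\<close>
      cells left over are handled one by one with \<open>cell\<close>. Each level thus adds at most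
      \<open>b * C\<close> to the error.\<close>
    have level: "\<bar>real (card {x\<in>S. X k x < \<beta> \<and> K x \<in> I}) - real b ^ (J - k) * real \<beta> * len\<bar>
        \<le> real (k + 1) * real b * C" if "k \<le> M" "\<beta> \<le> b ^ k" for k \<beta>
      using that
    proof (induction k arbitrary: \<beta>)
      case 0
      then consider "\<beta> = 0" | "\<beta> = 1" by fastforce
      then show ?case
      proof cases
        case 1
        then show ?thesis using C0 by simp
      next
        case 2
        have "\<bar>real (card {x\<in>S. X 0 x < 1 \<and> K x \<in> I}) - real b ^ J * len\<bar> \<le> C"
          using cell[of 0 0] by (simp add: less_Suc_eq_0_disj)
        also have "C \<le> real b * C" using b1 C0 by (simp add: mult_le_cancel_right1)
        finally show ?thesis using 2 by simp
      qed
    next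
      case (Suc k)
      define \<beta>' r where "\<beta>' = \<beta> div b" and "r = \<beta> mod b"
      have \<beta>: "\<beta> = b * \<beta>' + r" "r < b" using b by (auto simp: \<beta>'_def r_def)
      have \<beta>'_le: "\<beta>' \<le> b ^ k"
        using div_le_mono[OF Suc.prems(2), of b] b by (simp add: \<beta>'_def)
      have less: "X (Suc k) x < b * \<beta>' \<longleftrightarrow> X k x < \<beta>'" for x
        unfolding X_div[of k x, symmetric] using b by (simp add: div_less_iff_less_mult mult.commute)
      have extra: "\<bar>real (card {x\<in>S. X (Suc k) x < b * \<beta>' + s \<and> K x \<in> I})
          - real b ^ (J - Suc k) * real (b * \<beta>' + s) * len\<bar> \<le> real (k + 1) * real b * C + real s * C"
        if "b * \<beta>' + s \<le> b ^ Suc k" for s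
        using that
      proof (induction s)
        case 0
        have "Suc k \<le> J" using Suc.prems True by (simp add: M_def)
        then have "J - k = Suc (J - Suc k)" by simp
        then have "real b ^ (J - k) = real b ^ (J - Suc k) * real b" by simp
        then show ?case using Suc.IH[OF _ \<beta>'_le] Suc.prems(1) less by (simp add: mult_ac)
      next
        case (Suc s)
        let ?x = "b * \<beta>' + s"
        have "{x\<in>S. X (Suc k) x < b * \<beta>' + Suc s \<and> K x \<in> I}
            = {x\<in>S. X (Suc k) x < ?x \<and> K x \<in> I} \<union> {x\<in>S. X (Suc k) x = ?x \<and> K x \<in> I}"
          by auto
        then have "card {x\<in>S. X (Suc k) x < b * \<beta>' + Suc s \<and> K x \<in> I}
            = card {x\<in>S. X (Suc k) x < ?x \<and> K x \<in> I} + card {x\<in>S. X (Suc k) x = ?x \<and> K x \<in> I}"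
          using fin by (simp only:) (intro card_Un_disjoint, auto)
        moreover have "\<bar>real (card {x\<in>S. X (Suc k) x = ?x \<and> K x \<in> I}) - real b ^ (J - Suc k) * len\<bar> \<le> C"
          using Suc.prems \<open>Suc k \<le> M\<close> by (intro cell) auto
        moreover have "\<bar>real (card {x\<in>S. X (Suc k) x < ?x \<and> K x \<in> I})
          - real b ^ (J - Suc k) * real ?x * len\<bar> \<le> real (k + 1) * real b * C + real s * C"
          using Suc.prems by (intro Suc.IH) auto
        moreover have "real b ^ (J - Suc k) * real (b * \<beta>' + Suc s) * len
            = real b ^ (J - Suc k) * real ?x * len + real b ^ (J - Suc k) * len"
          "real (Suc s) * C = real s * C + C"
          by (simp_all add: algebra_simps)
        ultimately show ?case by linarith
      qed
      have "real r * C \<le> real b * C" using \<beta>(2) C0 by (intro mult_right_mono) auto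
      moreover have "real (Suc k + 1) * real b * C = real (k + 1) * real b * C + real b * C"
        by (simp add: algebra_simps)
      ultimately show ?case using extra[of r] Suc.prems(2) \<beta>(1) by simp
    qed
    define W where "W = real (M + 1) * real b * C"
    have bM: "b ^ M > 0" using b by simp
    obtain \<alpha> \<beta> \<alpha>' \<beta>' where cells: "\<alpha> \<le> \<beta>" "\<beta> \<le> b ^ M" "\<alpha>' \<le> \<beta>'" "\<beta>' \<le> b ^ M"
      "\<And>X (z::real). real X \<le> z * real (b ^ M) \<Longrightarrow> z * real (b ^ M) \<le> real X + 1 \<Longrightarrow> \<alpha> \<le> X \<Longrightarrow> X < \<beta> \<Longrightarrow> z \<in> I'"
      "\<And>X (z::real). X < b ^ M \<Longrightarrow> real X \<le> z * real (b ^ M) \<Longrightarrow> z * real (b ^ M) \<le> real X + 1 \<Longrightarrow> z \<in> I' \<Longrightarrow> \<alpha>' \<le> X \<and> X < \<beta>'"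
      "real (b ^ M) * measure lborel I' - 3 \<le> real \<beta> - real \<alpha>"
      "real \<beta>' - real \<alpha>' \<le> real (b ^ M) * measure lborel I' + 3"
      using interval_cells[OF I' bM] by blast
    have JM: "J - M = c" using True by (simp add: M_def)
    \<comment> \<open>A range of cells is the difference of two initial segments, hence the factor
      2.\<close>
    have rng: "\<bar>real (card {x\<in>S. \<alpha> \<le> X M x \<and> X M x < \<beta> \<and> K x \<in> I}) - real b ^ c * (real \<beta> - real \<alpha>) * len\<bar> \<le> 2 * W"
      if "\<alpha> \<le> \<beta>" "\<beta> \<le> b ^ M" for \<alpha> \<beta>
    proof -
      have "{x\<in>S. X M x < \<beta> \<and> K x \<in> I}
          = {x\<in>S. X M x < \<alpha> \<and> K x \<in> I} \<union> {x\<in>S. \<alpha> \<le> X M x \<and> X M x < \<beta> \<and> K x \<in> I}"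
        using that by auto
      then have "card {x\<in>S. X M x < \<beta> \<and> K x \<in> I}
          = card {x\<in>S. X M x < \<alpha> \<and> K x \<in> I} + card {x\<in>S. \<alpha> \<le> X M x \<and> X M x < \<beta> \<and> K x \<in> I}"
        using fin by (simp only:) (intro card_Un_disjoint, auto)
      moreover have "real b ^ c * (real \<beta> - real \<alpha>) * len = real b ^ c * real \<beta> * len - real b ^ c * real \<alpha> * len"
        by (simp add: algebra_simps)
      ultimately show ?thesis
        using level[of M \<alpha>] level[of M \<beta>] that unfolding JM W_def[symmetric] by simp
    qed
    have "{x\<in>S. \<alpha> \<le> X M x \<and> X M x < \<beta> \<and> K x \<in> I} \<subseteq> {x\<in>S. K x \<in> I \<and> V x \<in> I'}"
      "{x\<in>S. K x \<in> I \<and> V x \<in> I'} \<subseteq> {x\<in>S. \<alpha>' \<le> X M x \<and> X M x < \<beta>' \<and> K x \<in> I}"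
      using cells(5)[OF X_cell[where k = M, folded of_nat_power]]
        cells(6)[OF X_less X_cell[where k = M, folded of_nat_power]]
      by auto
    then have "real (card {x\<in>S. \<alpha> \<le> X M x \<and> X M x < \<beta> \<and> K x \<in> I}) \<le> real (card {x\<in>S. K x \<in> I \<and> V x \<in> I'})"
      "real (card {x\<in>S. K x \<in> I \<and> V x \<in> I'}) \<le> real (card {x\<in>S. \<alpha>' \<le> X M x \<and> X M x < \<beta>' \<and> K x \<in> I})"
      using fin by (auto intro!: of_nat_mono card_mono)
    moreover have "real b ^ c * (real b ^ M * len' - 3) * len \<le> real b ^ c * (real \<beta> - real \<alpha>) * len"
      using cells(7) len by (intro mult_right_mono mult_left_mono) (auto simp: len'_def)
    moreover have "real b ^ c * (real \<beta>' - real \<alpha>') * len \<le> real b ^ c * (real b ^ M * len' + 3) * len"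
      using cells(8) len by (intro mult_right_mono mult_left_mono) (auto simp: len'_def)
    moreover have "real b ^ J = real b ^ c * real b ^ M"
      using True by (simp add: M_def flip: power_add)
    then have "real b ^ c * (real b ^ M * len' + 3) * len = real b ^ J * (len * len') + C * len"
      "real b ^ c * (real b ^ M * len' - 3) * len = real b ^ J * (len * len') - C * len"
      by (simp_all add: C_def algebra_simps)
    \<comment> \<open>Replacing \<open>I'\<close> by whole cells of level \<open>M\<close> costs at
      most 3 cells, that is \<open>C * len\<close> in the expected count. Together with the
      \<open>2 * W\<close> from \<open>rng\<close> this makes \<open>3 * W\<close>, and
      \<open>C\<close> contributes the other factor 3 of the constant 9.\<close>
    moreover have "C * len \<le> W"
    proof -
      have "C * len \<le> C" using len C0 by (simp add: mult_left_le)
      also have "\<dots> \<le> 1 * (real b * C)" using b1 C0 by (simp add: mult_le_cancel_right1)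
      also have "1 * (real b * C) \<le> real (M + 1) * (real b * C)"
        using C0 by (intro mult_right_mono) auto
      finally show ?thesis by (simp add: W_def mult_ac)
    qed
    ultimately have "\<bar>real (card {x\<in>S. K x \<in> I \<and> V x \<in> I'}) - real b ^ J * (len * len')\<bar> \<le> 3 * W"
      using rng[OF cells(1,2)] rng[OF cells(3,4)] by linarith
    also have "3 * W = 9 * real b ^ (c + 1) * real (M + 1)"
      by (simp add: W_def C_def)
    also have "\<dots> \<le> 9 * real b ^ (c + 1) * real (J + 1)"
      by (intro mult_left_mono) (auto simp: M_def)
    finally show ?thesis by (simp add: len_def len'_def)
  qed
qed

text \<open>Induction on the number \<open>i\<close> of base-\<open>b\<close> digits of
  \<open>m\<close>, with the scale \<open>J\<close> left general: the last digit \<open>r\<close>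
  splits \<open>b ^ J * m\<close> into \<open>b ^ Suc J * m'\<close> and \<open>r\<close> blocks of
  length \<open>b ^ J\<close>. Every digit thus costs at most \<open>b\<close> blocks, each with
  error at most \<open>C * (J + i)\<close>.\<close>

lemma block_count_bound:
  fixes S :: "nat set" and b :: nat and \<mu> C :: real
  assumes C: "C \<ge> 0"
    and block: "\<And>J s. \<bar>real (card {n\<in>{s * b ^ J..<Suc s * b ^ J}. n \<in> S}) - real b ^ J * \<mu>\<bar> \<le> C * real (J + 1)"
    and "m < b ^ i"
  shows "\<bar>real (card {n. n < b ^ J * m \<and> n \<in> S}) - real (b ^ J * m) * \<mu>\<bar> \<le> real i * real b * C * real (J + i)"
  using assms(3)
proof (induction i arbitrary: m J)
  case (Suc i)
  define m' r where "m' = m div b" and "r = m mod b"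
  have b: "b > 0" using Suc.prems by (cases "b = 0") auto
  have m: "m = b * m' + r" "r < b" using b by (auto simp: m'_def r_def)
  have m': "m' < b ^ i" using Suc.prems b by (simp add: m'_def div_less_iff_less_mult mult.commute)
  have extra: "\<bar>real (card {n. n < b ^ J * (b * m' + s) \<and> n \<in> S}) - real (b ^ J * (b * m' + s)) * \<mu>\<bar>
      \<le> real i * real b * C * real (Suc J + i) + real s * (C * real (J + 1))" for s
  proof (induction s)
    case 0
    show ?case using Suc.IH[OF m', of "Suc J"] by (simp add: mult_ac)
  next
    case (Suc s)
    let ?x = "b * m' + s"
    define N0 where "N0 = ?x * b ^ J"
    have N0: "b ^ J * ?x = N0" "b ^ J * (b * m' + Suc s) = N0 + b ^ J" "Suc ?x * b ^ J = N0 + b ^ J"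
      by (simp_all add: N0_def algebra_simps)
    have "{n. n < N0 + b ^ J \<and> n \<in> S} = {n. n < N0 \<and> n \<in> S} \<union> {n\<in>{N0..<N0 + b ^ J}. n \<in> S}"
      by auto
    also have "card \<dots> = card {n. n < N0 \<and> n \<in> S} + card {n\<in>{N0..<N0 + b ^ J}. n \<in> S}"
      by (intro card_Un_disjoint) auto
    finally have "real (card {n. n < N0 + b ^ J \<and> n \<in> S})
      = real (card {n. n < N0 \<and> n \<in> S}) + real (card {n\<in>{N0..<N0 + b ^ J}. n \<in> S})"
      by (simp only: of_nat_add)
    moreover have "real (N0 + b ^ J) * \<mu> = real N0 * \<mu> + real b ^ J * \<mu>"
      "real (Suc s) * (C * real (J + 1)) = real s * (C * real (J + 1)) + C * real (J + 1)"
      by (simp_all add: algebra_simps)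
    moreover have "\<bar>x + y - (p + e)\<bar> \<le> u + (w + v)"
      if "\<bar>x - p\<bar> \<le> u + w" "\<bar>y - e\<bar> \<le> v" for x y p e u v w :: real
      using that by linarith
    ultimately show ?case
      using Suc.IH block[of ?x J] unfolding N0 N0_def[symmetric] by (simp only:)
  qed
  have "real r * (C * real (J + 1)) \<le> real b * (C * real (Suc J + i))"
    using m(2) C by (intro mult_mono) auto
  also have "real i * real b * C * real (Suc J + i) + \<dots> = real (Suc i) * real b * C * real (J + Suc i)"
    by (simp add: algebra_simps)
  finally show ?case using extra[of r] m(1) by simp
qed simp

lemma measure_lborel_Times:
  fixes I I' :: "real set"
  assumes "is_interval I" "is_interval I'"
  shows "measure lborel (I \<times> I') = measure lborel I * measure lborel I'"
proof -
  have "I \<in> sets lborel" "I' \<in> sets lborel"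
    using assms by (auto intro: real_interval_borel_measurable)
  then have "emeasure (lborel \<Otimes>\<^sub>M lborel) (I \<times> I') = emeasure lborel I * emeasure lborel I'"
    by (rule lborel.emeasure_pair_measure_Times)
  then show ?thesis by (simp add: lborel_prod measure_def enn2real_mult)
qed

section \<open>Polynomials and Laurent series\<close>

text \<open>Bounding the support instead of the degree admits the zero polynomial also for
  \<open>n = 0\<close>, so that this is a vector space of dimension \<open>n\<close> over a field in
  every case.\<close>

definition polys_below :: "nat \<Rightarrow> 'f::zero poly set" where
  "polys_below n = {f. \<forall>i\<ge>n. coeff f i = 0}"

lemma polys_below_iff: "f \<in> polys_below n \<longleftrightarrow> f = 0 \<or> degree f < n"
  by (auto simp: polys_below_def coeff_eq_0)
     (metis leading_coeff_0_iff linorder_not_less)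

lemma polys_below_mono: "f \<in> polys_below m \<Longrightarrow> m \<le> n \<Longrightarrow> f \<in> polys_below n"
  by (auto simp: polys_below_def)

lemma polys_below_0 [simp]: "0 \<in> polys_below n"
  by (simp add: polys_below_def)

lemma polys_below_add: "f \<in> polys_below n \<Longrightarrow> g \<in> polys_below n \<Longrightarrow> f + g \<in> polys_below n"
  for f g :: "'f::comm_monoid_add poly"
  by (auto simp: polys_below_def)

lemma polys_below_diff: "f \<in> polys_below n \<Longrightarrow> g \<in> polys_below n \<Longrightarrow> f - g \<in> polys_below n"
  for f g :: "'f::ab_group_add poly"
  by (auto simp: polys_below_def)

lemma polys_below_sum: "(\<And>i. i \<in> A \<Longrightarrow> f i \<in> polys_below n) \<Longrightarrow> sum f A \<in> polys_below n"
  for f :: "_ \<Rightarrow> 'f::comm_monoid_add poly"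
  by (auto simp: polys_below_def coeff_sum)

lemma polys_below_mult:
  fixes f g :: "'f::idom poly"
  assumes "f \<in> polys_below n" "degree g \<le> m"
  shows "f * g \<in> polys_below (n + m)"
  using assms degree_mult_le[of f g] by (auto simp: polys_below_iff)

lemma
  shows finite_polys_below [simp]: "finite (polys_below n :: 'f::{finite,zero} poly set)"
    and card_polys_below: "card (polys_below n :: 'f::{finite,zero} poly set) = CARD('f) ^ n"
proof -
  have "finite (polys_below n :: 'f poly set) \<and> card (polys_below n :: 'f poly set) = CARD('f) ^ n"
  proof (induction n)
    case 0
    have "(polys_below 0 :: 'f poly set) = {0}" by (auto simp: polys_below_def poly_eq_iff)
    then show ?case by simp
  next
    case (Suc n)
    let ?g = "\<lambda>(x, f). pCons x f :: 'f poly"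
    have "polys_below (Suc n) = ?g ` (UNIV \<times> polys_below n)"
    proof (intro equalityI subsetI)
      fix f :: "'f poly" assume f: "f \<in> polys_below (Suc n)"
      obtain x h where h: "f = pCons x h" by (cases f)
      have "coeff h i = 0" if "i \<ge> n" for i
        using f that unfolding h polys_below_def by (metis (mono_tags, lifting) Suc_le_mono coeff_pCons_Suc mem_Collect_eq)
      then show "f \<in> ?g ` (UNIV \<times> polys_below n)" using h by (auto simp: polys_below_def)
    qed (auto simp: polys_below_def coeff_pCons split: nat.splits)
    moreover have "inj_on ?g (UNIV \<times> polys_below n)" by (auto simp: inj_on_def)
    ultimately show ?case using Suc.IH by (simp add: card_image card_cartesian_product)
  qed
  then show "finite (polys_below n :: 'f poly set)" "card (polys_below n :: 'f poly set) = CARD('f) ^ n"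
    by auto
qed

lemma poly_eq_digit_sum:
  fixes P A :: "'f::field poly"
  assumes "degree P \<ge> 1" "A \<in> polys_below (degree P * n)"
  shows "A = (\<Sum>i<n. poly_digit P A i * P ^ i)"
proof -
  have *: "A = (\<Sum>i<k. poly_digit P A i * P ^ i) + A div P ^ k * P ^ k" for k
  proof (induction k)
    case (Suc k)
    have "A div P ^ k = poly_digit P A k + A div P ^ k div P * P"
      by (simp add: poly_digit_def)
    moreover have "A div P ^ k div P = A div P ^ Suc k"
      by (simp add: poly_div_mult_right power_Suc2 del: power_Suc)
    ultimately have "A div P ^ k = poly_digit P A k + A div P ^ Suc k * P" by simp
    then have "A div P ^ k * P ^ k = poly_digit P A k * P ^ k + A div P ^ Suc k * P ^ Suc k"
      by (simp only: distrib_right mult.assoc power_Suc)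
    with Suc show ?case by (simp add: add.assoc)
  qed simp
  have "degree (P ^ n) = degree P * n"
    using assms(1) by (subst degree_power_eq) auto
  then have "A div P ^ n = 0"
    using assms(2) by (auto simp: polys_below_iff div_poly_less)
  with *[of n] show ?thesis by simp
qed

lemma poly_digit_below: "degree P \<ge> 1 \<Longrightarrow> poly_digit P A i \<in> polys_below (degree P)"
  using poly_digit_expansion(2)[of P A i] by (simp add: polys_below_iff)

text \<open>The remainder modulo \<open>P ^ k\<close> is the sum formed by the first
  \<open>k\<close> digits.\<close>

lemma dvd_diff_of_digits_eq:
  fixes P A B :: "'f::field poly"
  assumes "\<And>i. i < k \<Longrightarrow> poly_digit P A i = poly_digit P B i"
  shows "P ^ k dvd A - B"
proof -
  have *: "A mod P ^ k = (\<Sum>i<k. poly_digit P A i * P ^ i)" for A :: "'f poly"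
  proof (induction k)
    case (Suc k)
    have "A mod (P ^ k * P) = P ^ k * (A div P ^ k mod P) + A mod P ^ k"
      by (rule poly_mod_mult_right)
    then show ?case using Suc.IH by (simp add: poly_digit_def mult.commute del: power_Suc add: power_Suc2)
  qed simp
  have "A mod P ^ k = B mod P ^ k" unfolding * using assms by (intro sum.cong) auto
  then show ?thesis by (simp add: mod_eq_dvd_iff)
qed

text \<open>Over a finite field with q elements this says that the norm is at most
  \<open>q powi (- n)\<close>. The form by coefficients covers the zero series, whose
  \<open>fls_subdegree\<close> is 0 by convention.\<close>

definition vanishes_below :: "int \<Rightarrow> 'f::zero fls \<Rightarrow> bool" where
  "vanishes_below n f \<longleftrightarrow> (\<forall>j<n. fls_nth f j = 0)"

lemma vanishes_below_0 [simp]: "vanishes_below n 0"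
  by (simp add: vanishes_below_def)

lemma vanishes_below_mono: "vanishes_below n f \<Longrightarrow> m \<le> n \<Longrightarrow> vanishes_below m f"
  by (simp add: vanishes_below_def)

lemma vanishes_below_add:
  fixes f g :: "'f::monoid_add fls"
  shows "vanishes_below n f \<Longrightarrow> vanishes_below n g \<Longrightarrow> vanishes_below n (f + g)"
  by (simp add: vanishes_below_def)

lemma vanishes_below_diff:
  fixes f g :: "'f::group_add fls"
  shows "vanishes_below n f \<Longrightarrow> vanishes_below n g \<Longrightarrow> vanishes_below n (f - g)"
  by (simp add: vanishes_below_def)

lemma vanishes_below_sum:
  fixes f :: "_ \<Rightarrow> 'f::comm_monoid_add fls"
  shows "(\<And>i. i \<in> A \<Longrightarrow> vanishes_below n (f i)) \<Longrightarrow> vanishes_below n (sum f A)"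
  by (induction A rule: infinite_finite_induct) (auto intro: vanishes_below_add)

lemma vanishes_below_subdegree: "f \<noteq> 0 \<Longrightarrow> vanishes_below n f \<longleftrightarrow> n \<le> fls_subdegree f"
  by (auto simp: vanishes_below_def intro: fls_subdegree_geI)

lemma vanishes_below_mult:
  fixes f g :: "'f::idom fls"
  assumes "vanishes_below m f" "vanishes_below n g"
  shows "vanishes_below (m + n) (f * g)"
proof (cases "f = 0 \<or> g = 0")
  case False
  then show ?thesis
    using assms by (simp add: vanishes_below_subdegree)
qed auto

section \<open>The embedding of polynomials into Laurent series\<close>

lemma map_poly_fls_const_hom: "comm_ring_hom (map_poly (fls_const :: 'f::field \<Rightarrow> 'f fls))"
proof -
  interpret comm_ring_hom "fls_const :: 'f \<Rightarrow> 'f fls"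
    by unfold_locales (auto simp: fls_plus_const)
  interpret map_poly_comm_ring_hom "fls_const :: 'f \<Rightarrow> 'f fls" ..
  show ?thesis ..
qed

lemma laurent_of_poly_hom: "comm_ring_hom (laurent_of_poly :: 'f::field poly \<Rightarrow> 'f fls)"
proof -
  interpret h: comm_ring_hom "map_poly (fls_const :: 'f \<Rightarrow> 'f fls)"
    by (rule map_poly_fls_const_hom)
  show ?thesis
    by unfold_locales (auto simp: laurent_of_poly_def h.hom_add h.hom_mult)
qed

interpretation laurent_of_poly: comm_ring_hom "laurent_of_poly :: 'f::field poly \<Rightarrow> 'f fls"
  by (rule laurent_of_poly_hom)

lemma laurent_of_poly_altdef:
  fixes A :: "'f::field poly"
  shows "laurent_of_poly A = (\<Sum>i\<le>degree A. fls_const (coeff A i) * laurent_t ^ i)"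
proof -
  have "degree (map_poly fls_const A :: 'f fls poly) = degree A"
    by (intro degree_map_poly) auto
  then show ?thesis
    by (simp add: laurent_of_poly_def poly_altdef coeff_map_poly)
qed

lemma laurent_of_poly_const [simp]: "laurent_of_poly [:c:] = fls_const c"
  by (simp add: laurent_of_poly_altdef)

lemma laurent_of_poly_mult_nth:
  fixes A :: "'f::field poly"
  shows "fls_nth (laurent_of_poly A * f) i = (\<Sum>j\<le>degree A. coeff A j * fls_nth f (i + int j))"
  unfolding laurent_of_poly_altdef sum_distrib_right fls_nth_sum mult.assoc
  by (simp add: fls_X_inv_power_times_conv_shift)

lemma laurent_of_poly_mult_nth':
  fixes A :: "'f::field poly"
  assumes "A \<in> polys_below n"
  shows "fls_nth (laurent_of_poly A * f) i = (\<Sum>j<n. coeff A j * fls_nth f (i + int j))"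
proof (cases "A = 0")
  case False
  then have "degree A < n" using assms by (simp add: polys_below_iff)
  then show ?thesis
    unfolding laurent_of_poly_mult_nth by (intro sum.mono_neutral_left) (auto simp: coeff_eq_0)
qed simp

lemma laurent_of_poly_nth:
  fixes A :: "'f::field poly"
  shows "fls_nth (laurent_of_poly A) i = (if i \<le> 0 then coeff A (nat (- i)) else 0)"
proof -
  have "fls_nth (laurent_of_poly A) i = (\<Sum>j\<le>degree A. if j = nat (- i) \<and> i \<le> 0 then coeff A j else 0)"
    using laurent_of_poly_mult_nth[of A 1 i] by (simp add: if_distrib cong: if_cong) (intro sum.cong, auto)
  also have "\<dots> = (if i \<le> 0 then coeff A (nat (- i)) else 0)"
    by (auto simp: sum.delta coeff_eq_0)
  finally show ?thesis .
qed

lemma laurent_of_poly_eq_0_iff [simp]: "laurent_of_poly A = 0 \<longleftrightarrow> A = 0"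
  for A :: "'f::field poly"
proof
  assume *: "laurent_of_poly A = 0"
  have "coeff A i = 0" for i
    using laurent_of_poly_nth[of A "- int i"] * by simp
  then show "A = 0" by (simp add: poly_eq_iff)
qed simp

lemma fls_subdegree_laurent_of_poly: "fls_subdegree (laurent_of_poly A) = - int (degree A)"
  for A :: "'f::field poly"
proof (cases "A = 0")
  case False
  then show ?thesis
    by (intro fls_subdegree_eqI) (auto simp: laurent_of_poly_nth coeff_eq_0)
qed simp

lemma vanishes_below_laurent_of_poly: "A \<in> polys_below n \<Longrightarrow> vanishes_below (1 - int n) (laurent_of_poly A)"
  for A :: "'f::field poly"
  by (auto simp: vanishes_below_def laurent_of_poly_nth polys_below_def)

lemma laurent_of_poly_vanishes_imp_0: "vanishes_below 1 (laurent_of_poly A) \<Longrightarrow> A = 0"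
  for A :: "'f::field poly"
proof (rule poly_eqI)
  fix n assume "vanishes_below 1 (laurent_of_poly A)"
  then have "fls_nth (laurent_of_poly A) (- int n) = 0" by (simp add: vanishes_below_def)
  then show "coeff A n = coeff 0 n" by (simp add: laurent_of_poly_nth)
qed

section \<open>Norm and fractional part\<close>

lemma laurent_norm_of_poly:
  fixes A :: "'f::{finite,field} poly"
  shows "A \<noteq> 0 \<Longrightarrow> laurent_norm (laurent_of_poly A) = real CARD('f) ^ degree A"
  by (simp add: laurent_norm_def fls_subdegree_laurent_of_poly)

lemma laurent_norm_nonneg [simp]: "laurent_norm f \<ge> 0"
  by (simp add: laurent_norm_def)

lemma card_field_ge_2: "CARD('f::{finite,zero_neq_one}) \<ge> 2"
proof -
  have "card {0::'f, 1} \<le> CARD('f)" by (intro card_mono) auto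
  then show ?thesis by simp
qed

lemma laurent_norm_ge:
  fixes f :: "'f::{finite,field} fls"
  assumes "\<not> vanishes_below (n + 1) f"
  shows "laurent_norm f \<ge> real CARD('f) powi (- n)"
proof -
  have "f \<noteq> 0" using assms by auto
  moreover from this have "fls_subdegree f \<le> n" using assms by (simp add: vanishes_below_subdegree)
  ultimately show ?thesis
    using card_field_ge_2[where 'f = 'f] by (auto simp: laurent_norm_def intro!: power_int_increasing)
qed

lemma laurent_norm_less:
  fixes f :: "'f::{finite,field} fls"
  assumes "vanishes_below (n + 1) f"
  shows "laurent_norm f < real CARD('f) powi (- n)"
proof (cases "f = 0")
  case False
  then have "n + 1 \<le> fls_subdegree f" using assms by (simp add: vanishes_below_subdegree)
  then show ?thesis
    using card_field_ge_2[where 'f = 'f] False by (auto simp: laurent_norm_def intro!: power_int_strict_increasing)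
qed (use card_field_ge_2[where 'f = 'f] in \<open>simp add: laurent_norm_def\<close>)

lemma laurent_frac_nth: "fls_nth (laurent_frac f) i = (if i \<ge> 1 then fls_nth f i else 0)"
  by (auto simp: laurent_frac_def nth_less_subdegree_zero)

lemma laurent_frac_diff: "laurent_frac (f - g) = laurent_frac f - laurent_frac g"
  by (rule fls_eqI) (simp add: laurent_frac_nth)

lemma laurent_frac_poly_add [simp]: "laurent_frac (laurent_of_poly A + g) = laurent_frac g"
  by (rule fls_eqI) (simp add: laurent_frac_nth laurent_of_poly_nth)

lemma laurent_frac_id: "vanishes_below 1 g \<Longrightarrow> laurent_frac g = g"
  by (rule fls_eqI) (auto simp: laurent_frac_nth vanishes_below_def)

text \<open>Only the terms up to index \<open>j\<close> contribute to the coefficient at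
  \<open>j\<close>, so the limit \<open>s\<close> can be written down coefficient by coefficient.
  Agreement of all coefficients below \<open>n\<close> is closeness in the \<open>fls_X\<close>-adic
  metric.\<close>

lemma fls_sums_exists:
  fixes f :: "nat \<Rightarrow> 'f::field fls"
  assumes "\<And>i. vanishes_below (int i) (f i)"
  shows "summable f" and "vanishes_below (int n) (suminf f - sum f {..<n})"
proof -
  define s where "s = fps_to_fls (Abs_fps (\<lambda>j. fls_nth (sum f {..j}) (int j)))"
  have fn: "fls_nth (f i) j = 0" if "j < int i" for i j
    using assms[of i] that by (simp add: vanishes_below_def)
  have s: "vanishes_below (int n) (s - sum f {..<n})" for n
    unfolding vanishes_below_def
  proof (intro allI impI)
    fix j assume j: "j < int n"
    show "fls_nth (s - sum f {..<n}) j = 0"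
    proof (cases "j < 0")
      case True
      then show ?thesis by (simp add: s_def fls_nth_sum fn)
    next
      case False
      then have "fls_nth s j = (\<Sum>i\<le>nat j. fls_nth (f i) j)"
        by (simp add: s_def fls_nth_sum)
      also have "\<dots> = (\<Sum>i<n. fls_nth (f i) j)"
        using j False by (intro sum.mono_neutral_left) (auto intro!: fn)
      finally show ?thesis by (simp add: fls_nth_sum)
    qed
  qed
  have "f sums s"
    unfolding sums_def tendsto_iff
  proof (intro allI impI)
    fix e :: real assume "e > 0"
    then obtain k where k: "inverse (2 ^ k) < e"
      using real_arch_pow_inv[of e "1/2"] by (auto simp: power_one_over field_simps)
    have "dist (sum f {..<n}) s < e" if "n \<ge> k" for n
    proof (cases "sum f {..<n} = s")
      case False
      have "int n \<le> fls_subdegree (s - sum f {..<n})"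
        using s[of n] False by (simp add: vanishes_below_subdegree)
      then have *: "int n \<le> fls_subdegree (sum f {..<n} - s)"
        by (simp add: fls_subdegree_minus_sym)
      then have "dist (sum f {..<n}) s = inverse (2 ^ nat (fls_subdegree (sum f {..<n} - s)))"
        using False by (simp add: dist_fls_def)
      also have "\<dots> \<le> inverse (2 ^ k)"
        using * that by (intro le_imp_inverse_le power_increasing) auto
      finally show ?thesis using k by simp
    qed (use \<open>e > 0\<close> in simp)
    then show "\<forall>\<^sub>F n in sequentially. dist (sum f {..<n}) s < e"
      by (auto simp: eventually_sequentially)
  qed
  then show "summable f" "vanishes_below (int n) (suminf f - sum f {..<n})"
    using s by (auto simp: sums_iff)
qed


text \<open>The tail inherits the order \<open>m\<close> common to its terms, which may exceed the
  order \<open>n\<close> given by \<open>fls_sums_exists\<close>; in powers of \<open>1 / P\<close>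
  the order grows by \<open>degree P\<close> per term.\<close>

lemma fls_suminf_vanishes:
  fixes f :: "nat \<Rightarrow> 'f::field fls"
  assumes "\<And>i. vanishes_below (int i) (f i)" "\<And>i. i \<ge> n \<Longrightarrow> vanishes_below m (f i)"
  shows "vanishes_below m (suminf f - sum f {..<n})"
  unfolding vanishes_below_def
proof (intro allI impI)
  fix j assume j: "j < m"
  \<comment> \<open>Beyond \<open>N\<close> the general bound already kills the coefficient at
    \<open>j\<close>, and between \<open>n\<close> and \<open>N\<close> there are finitely many
    terms.\<close>
  define N where "N = max n (nat (j + 1))"
  have S: "sum f {..<N} = sum f {..<n} + sum f {n..<N}"
    using sum.atLeastLessThan_concat[of 0 n N f] by (simp add: N_def lessThan_atLeast0)
  have "fls_nth (suminf f - sum f {..<n}) j = fls_nth (suminf f - sum f {..<N}) j + fls_nth (sum f {n..<N}) j"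
    unfolding S by simp
  moreover have "fls_nth (suminf f - sum f {..<N}) j = 0"
    using fls_sums_exists(2)[OF assms(1), of N] by (simp add: vanishes_below_def N_def)
  moreover have "fls_nth (sum f {n..<N}) j = 0"
    using assms(2) j by (simp add: fls_nth_sum vanishes_below_def)
  ultimately show "fls_nth (suminf f - sum f {..<n}) j = 0" by simp
qed

section \<open>Expansions in powers of a polynomial\<close>

text \<open>Here \<open>\<Psi> j\<close> is the shifted series
  \<open>\<Sum>l\<ge>1. a (l + j) / P ^ l\<close>, captured by two properties: multiplication by
  \<open>P\<close> releases the leading digit as a constant and passes to the next shift, and no
  polynomial part is present.\<close>

locale P_expansion =
  fixes P :: "'f::field poly" and a :: "nat \<Rightarrow> 'f" and \<Psi> :: "nat \<Rightarrow> 'f fls"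
  assumes degree_P: "degree P \<ge> 1"
    and shift: "\<And>j. laurent_of_poly P * \<Psi> j = fls_const (a (Suc j)) + \<Psi> (Suc j)"
    and vanishes: "\<And>j. vanishes_below (int (degree P)) (\<Psi> j)"

lemma P_expansion_exists:
  fixes P :: "'f::field poly"
  assumes d: "degree P \<ge> 1"
  shows "\<exists>\<Psi>. P_expansion P a \<Psi> \<and> \<Psi> 0 = (\<Sum>i. fls_const (a (i + 1)) / laurent_of_poly P ^ (i + 1))"
proof -
  define p where "p = laurent_of_poly P"
  define f where "f i = fls_const (a (i + 1)) / p ^ (i + 1)" for i
  define \<Phi> where "\<Phi> = suminf f"
  \<comment> \<open>The tail from index \<open>j\<close> on, scaled by \<open>p ^ j\<close>: the
    tail has order at least \<open>degree P * (j + 1)\<close>, of which the scaling leaves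
    \<open>degree P\<close>.\<close>
  define \<Psi> where "\<Psi> j = p ^ j * (\<Phi> - sum f {..<j})" for j
  have p0: "p \<noteq> 0" using d by (auto simp: p_def)
  have p_sub: "fls_subdegree (p ^ j) = - int (degree P * j)" for j
    by (simp add: p_def fls_subdegree_pow fls_subdegree_laurent_of_poly)
  have van_f: "vanishes_below (int (degree P * (i + 1))) (f i)" for i
  proof -
    have "vanishes_below (int (degree P * (i + 1))) (inverse (p ^ (i + 1)))"
      using p0 by (subst vanishes_below_subdegree) (simp_all only: fls_inverse_subdegree p_sub inverse_nonzero_iff_nonzero power_not_zero, simp_all)
    moreover have "vanishes_below 0 (fls_const (a (i + 1)))"
      by (simp add: vanishes_below_def)
    ultimately have "vanishes_below (0 + int (degree P * (i + 1))) (fls_const (a (i + 1)) * inverse (p ^ (i + 1)))"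
      by (rule vanishes_below_mult[rotated])
    then show ?thesis by (simp add: f_def field_simps)
  qed
  have "int i \<le> int (degree P * (i + 1))" for i
    using mult_le_mono[OF d, of i "i + 1"] by linarith
  then have van_i: "vanishes_below (int i) (f i)" for i
    using van_f vanishes_below_mono by blast
  have "vanishes_below (int (degree P)) (\<Psi> j)" for j
  proof -
    have "vanishes_below (int (degree P * (j + 1))) (\<Phi> - sum f {..<j})"
      unfolding \<Phi>_def using van_i
    proof (rule fls_suminf_vanishes)
      fix i assume "j \<le> i"
      then have "degree P * (j + 1) \<le> degree P * (i + 1)" by simp
      then show "vanishes_below (int (degree P * (j + 1))) (f i)"
        by (intro vanishes_below_mono[OF van_f]) (simp only: of_nat_le_iff)
    qed
    moreover have "vanishes_below (- int (degree P * j)) (p ^ j)"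
      using p0 by (subst vanishes_below_subdegree) (auto simp: p_sub)
    ultimately have "vanishes_below (- int (degree P * j) + int (degree P * (j + 1))) (\<Psi> j)"
      unfolding \<Psi>_def by (intro vanishes_below_mult)
    then show ?thesis by (simp add: algebra_simps)
  qed
  moreover have "p * \<Psi> j = fls_const (a (Suc j)) + \<Psi> (Suc j)" for j
  proof -
    have "p ^ Suc j * f j = fls_const (a (Suc j))" using p0 by (simp add: f_def)
    then show ?thesis by (simp add: \<Psi>_def algebra_simps)
  qed
  ultimately have "P_expansion P a \<Psi>"
    using d by unfold_locales (auto simp: p_def)
  moreover have "\<Psi> 0 = suminf f" by (simp add: \<Psi>_def \<Phi>_def)
  ultimately show ?thesis unfolding f_def p_def by blast
qed

context P_expansion
begin

lemma P_nonzero: "P \<noteq> 0"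
  using degree_P by auto

lemma power_shift: "\<exists>C. laurent_of_poly (P ^ j) * \<Psi> i = laurent_of_poly C + \<Psi> (i + j)"
proof (induction j)
  case 0
  show ?case by (intro exI[of _ 0]) simp
next
  case (Suc j)
  then obtain C where C: "laurent_of_poly (P ^ j) * \<Psi> i = laurent_of_poly C + \<Psi> (i + j)" by blast
  have "laurent_of_poly (P ^ Suc j) * \<Psi> i = laurent_of_poly P * (laurent_of_poly (P ^ j) * \<Psi> i)"
    by (simp add: laurent_of_poly.hom_mult laurent_of_poly.hom_power)
  also have "\<dots> = laurent_of_poly (P * C + [:a (Suc (i + j)):]) + \<Psi> (i + Suc j)"
    unfolding C by (simp add: distrib_left shift laurent_of_poly.hom_mult laurent_of_poly.hom_add)
  finally show ?case by blast
qed

lemma frac_mult_power: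
  "laurent_frac (laurent_of_poly (N * P ^ k) * \<Psi> i) = laurent_frac (laurent_of_poly N * \<Psi> (i + k))"
proof -
  obtain C where C: "laurent_of_poly (P ^ k) * \<Psi> i = laurent_of_poly C + \<Psi> (i + k)"
    using power_shift by blast
  have "laurent_of_poly (N * P ^ k) * \<Psi> i = laurent_of_poly N * (laurent_of_poly C + \<Psi> (i + k))"
    unfolding C[symmetric] by (simp add: laurent_of_poly.hom_mult)
  also have "\<dots> = laurent_of_poly (N * C) + laurent_of_poly N * \<Psi> (i + k)"
    by (simp add: distrib_left laurent_of_poly.hom_mult)
  finally show ?thesis by simp
qed

text \<open>The degree of a digit is less than the order of \<open>\<Psi> i\<close>, so the product
  has no polynomial part and fractional parts of digit sums can be taken term by term.\<close>

lemma vanishes_digit_mult: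
  "b \<in> polys_below (degree P) \<Longrightarrow> vanishes_below 1 (laurent_of_poly b * \<Psi> i)"
  using vanishes_below_mult[OF vanishes_below_laurent_of_poly vanishes, of b "degree P" i] by simp

lemma frac_digit_sum:
  assumes "\<And>j. j < n \<Longrightarrow> b j \<in> polys_below (degree P)"
  shows "laurent_frac (laurent_of_poly (\<Sum>j<n. b j * P ^ j) * \<Psi> i) = (\<Sum>j<n. laurent_of_poly (b j) * \<Psi> (i + j))"
proof -
  have "\<forall>j. \<exists>C. laurent_of_poly (P ^ j) * \<Psi> i = laurent_of_poly C + \<Psi> (i + j)"
    using power_shift by blast
  from choice[OF this] obtain C where
    C: "laurent_of_poly (P ^ j) * \<Psi> i = laurent_of_poly (C j) + \<Psi> (i + j)" for j
    by blast
  have "laurent_of_poly (\<Sum>j<n. b j * P ^ j) * \<Psi> i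
      = (\<Sum>j<n. laurent_of_poly (b j) * (laurent_of_poly (P ^ j) * \<Psi> i))"
    by (simp add: laurent_of_poly.hom_sum laurent_of_poly.hom_mult sum_distrib_right mult.assoc)
  also have "\<dots> = laurent_of_poly (\<Sum>j<n. b j * C j) + (\<Sum>j<n. laurent_of_poly (b j) * \<Psi> (i + j))"
    unfolding C by (simp add: distrib_left sum.distrib laurent_of_poly.hom_sum laurent_of_poly.hom_mult)
  finally have "laurent_frac (laurent_of_poly (\<Sum>j<n. b j * P ^ j) * \<Psi> i)
      = laurent_frac (\<Sum>j<n. laurent_of_poly (b j) * \<Psi> (i + j))" by simp
  also have "\<dots> = (\<Sum>j<n. laurent_of_poly (b j) * \<Psi> (i + j))"
    using assms by (intro laurent_frac_id vanishes_below_sum vanishes_digit_mult) auto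
  finally show ?thesis .
qed

text \<open>
  Multiplying the fractional part by \<open>P\<close> moves its leading \<open>P\<close>-adic digit
  \<open>\<Sum>j. a (i + j + 1) * b j\<close> into the polynomial part, so that the digits can be read off one by one.
\<close>

lemma frac_digits_vanish:
  assumes "\<And>j. j < n \<Longrightarrow> b j \<in> polys_below (degree P)"
    and "vanishes_below (int (degree P * L) + 1) (\<Sum>j<n. laurent_of_poly (b j) * \<Psi> (i + j))"
    and "l < L"
  shows "(\<Sum>j<n. smult (a (Suc (i + j + l))) (b j)) = 0"
  using assms(2,3)
proof (induction L arbitrary: i l)
  case (Suc L)
  define R where "R i = (\<Sum>j<n. laurent_of_poly (b j) * \<Psi> (i + j))" for i
  define B where "B = (\<Sum>j<n. smult (a (Suc (i + j))) (b j))"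
  have "laurent_of_poly P * R i = (\<Sum>j<n. laurent_of_poly (b j) * (laurent_of_poly P * \<Psi> (i + j)))"
    by (simp add: R_def sum_distrib_left mult_ac)
  also have "\<dots> = (\<Sum>j<n. laurent_of_poly (smult (a (Suc (i + j))) (b j))) + R (Suc i)"
  proof -
    have "laurent_of_poly (smult c B) = laurent_of_poly B * fls_const c" for c and B :: "'f poly"
      by (simp flip: laurent_of_poly_const laurent_of_poly.hom_mult)
    then show ?thesis unfolding shift R_def by (simp add: distrib_left sum.distrib)
  qed
  finally have PR: "laurent_of_poly P * R i = laurent_of_poly B + R (Suc i)"
    by (simp add: B_def laurent_of_poly.hom_sum)
  \<comment> \<open>Multiplication by \<open>P\<close> lowers the order by \<open>degree P\<close>,
    from the level \<open>Suc L\<close> to the level \<open>L\<close>. The left side of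
    \<open>PR\<close> and \<open>R (Suc i)\<close> are then both purely fractional, so the
    polynomial \<open>B\<close> must be 0, and \<open>R (Suc i)\<close> satisfies the hypothesis for
    \<open>L\<close>.\<close>
  have "P \<in> polys_below (Suc (degree P))" by (simp add: polys_below_iff)
  from vanishes_below_mult[OF vanishes_below_laurent_of_poly[OF this] Suc.prems(1)]
  have van: "vanishes_below (int (degree P * L) + 1) (laurent_of_poly P * R i)"
    by (simp add: R_def algebra_simps)
  have "vanishes_below 1 (R (Suc i))"
    unfolding R_def using assms(1) by (intro vanishes_below_sum vanishes_digit_mult) auto
  moreover have "vanishes_below 1 (laurent_of_poly P * R i)"
    using van by (rule vanishes_below_mono) simp
  ultimately have "vanishes_below 1 (laurent_of_poly P * R i - R (Suc i))"
    by (intro vanishes_below_diff)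
  then have B: "B = 0" using PR by (intro laurent_of_poly_vanishes_imp_0) simp
  show ?case
  proof (cases l)
    case 0
    then show ?thesis using B by (simp add: B_def)
  next
    case (Suc l')
    have "vanishes_below (int (degree P * L) + 1) (R (Suc i))" using van PR B by simp
    then show ?thesis using Suc.IH[of "Suc i" l'] Suc.prems(2) Suc by (simp add: R_def)
  qed
qed simp

end

section \<open>Hankel matrices\<close>

text \<open>A matrix with independent rows has a right inverse. The induction adds one row at a time
  and corrects the dual vectors found so far.\<close>

lemma dual_vectors_exist:
  fixes M :: "nat \<Rightarrow> nat \<Rightarrow> 'f::field"
  assumes "\<And>c. \<exists>l<L. c l \<noteq> 0 \<Longrightarrow> \<exists>j<m. (\<Sum>l<L. c l * M l j) \<noteq> 0"
  shows "\<exists>v. \<forall>l<L. \<forall>i<L. (\<Sum>j<m. v i j * M l j) = (if l = i then 1 else 0)"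
  using assms
proof (induction L)
  case (Suc L)
  define F where "F l w = (\<Sum>j<m. w j * M l j)" for l and w :: "nat \<Rightarrow> 'f"
  have F_diff: "F l (\<lambda>j. w j - r * w' j) = F l w - r * F l w'" for l w w' r
    by (simp add: F_def sum_subtractf sum_distrib_left algebra_simps)
  have F_sum: "F l (\<lambda>j. w j - (\<Sum>i<L. r i * w' i j)) = F l w - (\<Sum>i<L. r i * F l (w' i))" for l w w' r
  proof -
    have "F l (\<lambda>j. w j - (\<Sum>i<L. r i * w' i j)) = F l w - (\<Sum>j<m. \<Sum>i<L. r i * (w' i j * M l j))"
      by (simp add: F_def sum_subtractf sum_distrib_right left_diff_distrib mult.assoc)
    also have "(\<Sum>j<m. \<Sum>i<L. r i * (w' i j * M l j)) = (\<Sum>i<L. r i * F l (w' i))"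
      unfolding F_def sum_distrib_left by (rule sum.swap)
    finally show ?thesis .
  qed
  have "\<exists>j<m. (\<Sum>l<L. c l * M l j) \<noteq> 0" if "\<exists>l<L. c l \<noteq> 0" for c
  proof -
    from that obtain l where "l < L" "c l \<noteq> 0" by blast
    then have "\<exists>l<Suc L. (c(L := 0)) l \<noteq> 0" by (intro exI[of _ l]) auto
    then show ?thesis using Suc.prems[of "c(L := 0)"] by simp
  qed
  then obtain v where "\<forall>l<L. \<forall>i<L. F l (v i) = (if l = i then 1 else 0)"
    using Suc.IH unfolding F_def by blast
  then have v: "F l (v i) = (if l = i then 1 else 0)" if "l < L" "i < L" for l i
    using that by blast
  \<comment> \<open>These coefficients subtract from row \<open>L\<close> the combination of earlier
    rows that agrees with it on every \<open>v l\<close>. By independence the difference is nonzero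
    in some column \<open>j0\<close>, where its entry is \<open>g\<close>.\<close>
  obtain j0 where j0: "j0 < m"
    "(\<Sum>l<Suc L. (if l < L then - F L (v l) else 1) * M l j0) \<noteq> 0"
  proof -
    have "\<exists>l<Suc L. (if l < L then - F L (v l) else 1) \<noteq> 0" by (intro exI[of _ L]) auto
    from Suc.prems[OF this] show ?thesis using that by blast
  qed
  define g where "g = M L j0 - (\<Sum>l<L. M l j0 * F L (v l))"
  have "(\<Sum>l<Suc L. (if l < L then - F L (v l) else 1) * M l j0) = g"
    by (simp add: g_def sum_negf mult.commute)
  with j0 have g: "g \<noteq> 0" by simp
  \<comment> \<open>The unit vector at \<open>j0\<close>, corrected so that the earlier rows
    annihilate it; row \<open>L\<close> maps it to \<open>g\<close>.\<close>
  define u where "u j = (if j = j0 then 1 else 0) - (\<Sum>i<L. M i j0 * v i j)" for j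
  have "F l (\<lambda>j. if j = j0 then 1 else 0) = M l j0" for l
    using j0(1) by (simp add: F_def if_distrib[of "\<lambda>x. x * _"] sum.delta cong: if_cong)
  then have F_u: "F l u = M l j0 - (\<Sum>i<L. M i j0 * F l (v i))" for l
    unfolding u_def F_sum by simp
  have Fl_u: "F l u = 0" if "l < L" for l
    unfolding F_u using that by (simp add: v if_distrib[of "\<lambda>x. _ * x"] cong: if_cong)
  have FL_u: "F L u = g" unfolding F_u g_def ..
  define w where "w j = u j / g" for j
  have "F l w = F l u / g" for l
    by (simp add: F_def w_def sum_divide_distrib)
  then have w: "F l w = (if l = L then 1 else 0)" if "l < Suc L" for l
    using that Fl_u FL_u g by (auto simp: less_Suc_eq)
  \<comment> \<open>The old dual vectors lose a multiple of \<open>w\<close> so that row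
    \<open>L\<close> annihilates them; earlier rows do not see the change, since they annihilate
    \<open>w\<close>.\<close>
  define v' where "v' i = (if i < L then (\<lambda>j. v i j - F L (v i) * w j) else w)" for i
  have "F l (v' i) = (if l = i then 1 else 0)" if "l < Suc L" "i < Suc L" for l i
    using that by (auto simp: v'_def F_diff w v less_Suc_eq)
  then show ?case unfolding F_def by blast
qed simp

text \<open>Full column rank of all Hankel blocks with \<open>h + c\<close> rows and
  \<open>h + 1\<close> columns, wherever they start. For \<open>c = 1\<close> the blocks are square;
  larger \<open>c\<close> allows for a smaller positive infimum in \<open>Bad\<close>.\<close>

definition hankel_nonsingular :: "nat \<Rightarrow> (nat \<Rightarrow> 'f::field) \<Rightarrow> bool" where
  "hankel_nonsingular c a \<longleftrightarrow> (\<forall>k h w. (\<exists>j\<le>h. w j \<noteq> 0) \<longrightarrow>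
     (\<exists>i\<in>{1..h + c}. (\<Sum>j\<le>h. w j * a (i + j + k)) \<noteq> 0))"

lemma hankel_nonsingularD:
  assumes "hankel_nonsingular c a" "j \<le> h" "w j \<noteq> 0"
  obtains i where "1 \<le> i" "i \<le> h + c" "(\<Sum>j\<le>h. w j * a (i + j + k)) \<noteq> 0"
proof -
  have "\<exists>i\<in>{1..h + c}. (\<Sum>j\<le>h. w j * a (i + j + k)) \<noteq> 0"
    using assms unfolding hankel_nonsingular_def by blast
  then show ?thesis using that by auto
qed

lemma power_mult_power_int_minus:
  fixes q :: "'a::field"
  assumes "q \<noteq> 0"
  shows "q ^ h * q powi (- int (h + c)) = q powi (- int c)"
  using assms by (simp only: power_int_minus power_int_of_nat power_add) (simp add: field_simps)

lemma laurent_of_t: "laurent_of_poly [:0, 1:] = (laurent_t :: 'f::field fls)"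
  by (rule fls_eqI) (auto simp: laurent_of_poly_nth coeff_pCons split: nat.splits)

text \<open>A kernel vector \<open>w\<close> of a block is the coefficient vector of a nonzero
  \<open>N\<close> of degree at most \<open>h\<close> for which the first \<open>h + c\<close>
  coefficients of the fractional part vanish. The product of the two norms is then at most
  \<open>q ^ h * q powi (- int (h + c))\<close>, that is \<open>(1 / q) ^ c\<close>, and
  \<open>c\<close> is chosen to put this below the infimum.\<close>

lemma Bad_t_hankel_nonsingular:
  fixes a :: "nat \<Rightarrow> 'f::{finite,field}"
  assumes bad: "\<Theta> \<in> Bad [:0, 1:]" and nth: "\<And>i. i \<ge> 1 \<Longrightarrow> fls_nth \<Theta> (int i) = a i"
  shows "\<exists>c. hankel_nonsingular c a"
proof -
  define q where "q = real CARD('f)"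
  have q: "q > 1" using card_field_ge_2[where 'f = 'f] by (simp add: q_def)
  define s where "s N k = laurent_norm (laurent_of_poly N) *
      laurent_norm (laurent_frac (laurent_of_poly (N * [:0, 1:] ^ k) * \<Theta>))" for N :: "'f poly" and k :: nat
  define \<epsilon> where "\<epsilon> = Inf {s N k | N k. N \<noteq> 0}"
  have \<epsilon>: "\<epsilon> > 0" using bad by (simp add: Bad_def \<epsilon>_def s_def)
  have s_ge: "\<epsilon> \<le> s N k" if "N \<noteq> 0" for N k
    unfolding \<epsilon>_def using that by (intro cInf_lower bdd_belowI[of _ 0]) (auto simp: s_def)
  obtain c where c: "(1 / q) ^ c < \<epsilon>"
    using real_arch_pow_inv[OF \<epsilon>, of "1 / q"] q by auto
  have "\<exists>i\<in>{1..h + c}. (\<Sum>j\<le>h. w j * a (i + j + k)) \<noteq> 0" if w: "j0 \<le> h" "w j0 \<noteq> 0" for k h w j0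
  proof (rule ccontr)
    assume *: "\<not> ?thesis"
    define N where "N = (\<Sum>j\<le>h. monom (w j) j)"
    have coeff_N: "coeff N j = (if j \<le> h then w j else 0)" for j
      by (simp add: N_def coeff_sum sum.delta)
    then have N0: "N \<noteq> 0" using w by (metis coeff_0)
    have below: "N \<in> polys_below (Suc h)" by (simp add: polys_below_def coeff_N)
    have "fls_nth (laurent_of_poly (N * [:0, 1:] ^ k) * \<Theta>) (int i) = (\<Sum>j\<le>h. w j * a (i + j + k))"
      if "i \<ge> 1" for i
    proof -
      have "laurent_of_poly (N * [:0, 1:] ^ k) * \<Theta> = laurent_of_poly N * fls_shift (int k) \<Theta>"
        by (simp only: laurent_of_poly.hom_mult laurent_of_poly.hom_power laurent_of_t mult.assoc
            fls_X_inv_power_times_conv_shift(1))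
      then have "fls_nth (laurent_of_poly (N * [:0, 1:] ^ k) * \<Theta>) (int i)
          = (\<Sum>j\<le>h. coeff N j * fls_nth \<Theta> (int (i + j + k)))"
        using laurent_of_poly_mult_nth'[OF below] by (simp add: lessThan_Suc_atMost)
      also have "\<dots> = (\<Sum>j\<le>h. w j * a (i + j + k))"
        using that by (intro sum.cong) (simp_all add: coeff_N nth del: of_nat_add)
      finally show ?thesis .
    qed
    note coeffs = this
    have "vanishes_below (int (h + c) + 1) (laurent_frac (laurent_of_poly (N * [:0, 1:] ^ k) * \<Theta>))"
      unfolding vanishes_below_def
    proof (intro allI impI)
      fix i :: int assume i: "i < int (h + c) + 1"
      show "fls_nth (laurent_frac (laurent_of_poly (N * [:0, 1:] ^ k) * \<Theta>)) i = 0"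
      proof (cases "i \<ge> 1")
        case True
        define n where "n = nat i"
        have n: "i = int n" "1 \<le> n" "n \<le> h + c" using True i by (auto simp: n_def)
        have "(\<Sum>j\<le>h. w j * a (n + j + k)) = 0" using * n(2,3) by auto
        then show ?thesis using coeffs[OF n(2)] by (simp add: laurent_frac_nth n(1))
      qed (simp add: laurent_frac_nth)
    qed
    then have "laurent_norm (laurent_frac (laurent_of_poly (N * [:0, 1:] ^ k) * \<Theta>)) \<le> q powi (- int (h + c))"
      unfolding q_def by (intro less_imp_le laurent_norm_less)
    moreover have "laurent_norm (laurent_of_poly N) \<le> q ^ h"
      using N0 below q by (simp add: laurent_norm_of_poly polys_below_iff q_def[symmetric] power_increasing)
    ultimately have "s N k \<le> q ^ h * q powi (- int (h + c))"
      unfolding s_def by (intro mult_mono) (use q in auto)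
    also have "\<dots> = (1 / q) ^ c"
      using q by (subst power_mult_power_int_minus) (simp_all add: power_int_minus power_one_over inverse_eq_divide)
    also have "\<dots> < \<epsilon>" by (rule c)
    finally show False using s_ge[OF N0] by (simp add: not_le[symmetric])
  qed
  then show ?thesis unfolding hankel_nonsingular_def by blast
qed

text \<open>
  The transpose of a Hankel matrix is again one, so full column rank of the tall blocks makes the
  rows of the wide blocks independent.
\<close>

lemma hankel_dual_vectors:
  fixes a :: "nat \<Rightarrow> 'f::field"
  assumes "hankel_nonsingular c a" "L + c \<le> m"
  shows "\<exists>v. \<forall>l<L. \<forall>i<L. (\<Sum>j<m. v i j * a (Suc (k + j + l))) = (if l = i then 1 else 0)"
proof (rule dual_vectors_exist)
  fix w :: "nat \<Rightarrow> 'f" assume "\<exists>l<L. w l \<noteq> 0"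
  then obtain l where l: "l < L" "w l \<noteq> 0" by blast
  \<comment> \<open>The entries depend only on \<open>i + j\<close>, so coefficients of a
    combination of \<open>L\<close> rows act as a column vector with \<open>h = L - 1\<close>.
    Hankel rows are counted from 1, so the witness \<open>i\<close> becomes column
    \<open>i - 1\<close>, which is less than \<open>m\<close>.\<close>
  obtain i where i: "1 \<le> i" "i \<le> (L - 1) + c" "(\<Sum>j\<le>L - 1. w j * a (i + j + k)) \<noteq> 0"
    by (rule hankel_nonsingularD[OF assms(1), of l "L - 1" w k]) (use l in auto)
  have "(\<Sum>l<L. w l * a (Suc (k + (i - 1) + l))) = (\<Sum>j\<le>L - 1. w j * a (i + j + k))"
    using l i(1) by (intro sum.cong) (auto simp: add_ac)
  then show "\<exists>j<m. (\<Sum>l<L. w l * a (Suc (k + j + l))) \<noteq> 0"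
    using i l assms(2) by (intro exI[of _ "i - 1"]) auto
qed

section \<open>Consequences for expansions in powers of \<open>P\<close>: badness and the size of
  digit kernels\<close>

lemma digit_sum_below:
  fixes P :: "'f::field poly"
  assumes "\<And>j. j < n \<Longrightarrow> b j \<in> polys_below (degree P)"
  shows "(\<Sum>j<n. b j * P ^ j) \<in> polys_below (degree P * n)"
proof (rule polys_below_sum)
  fix j assume "j \<in> {..<n}"
  then have "b j * P ^ j \<in> polys_below (degree P + degree P * j)"
    using degree_power_le[of P j] assms by (intro polys_below_mult) auto
  moreover have "degree P + degree P * j \<le> degree P * n"
    using \<open>j \<in> {..<n}\<close> mult_le_mono2[of "Suc j" n "degree P"] by simp
  ultimately show "b j * P ^ j \<in> polys_below (degree P * n)" by (rule polys_below_mono)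
qed


lemma (in P_expansion) digits_of_poly:
  assumes "D \<in> polys_below (degree P * n)"
  shows "laurent_frac (laurent_of_poly (D * P ^ k) * \<Psi> 0)
    = (\<Sum>j<n. laurent_of_poly (poly_digit P D j) * \<Psi> (k + j))"
proof -
  have "laurent_frac (laurent_of_poly (D * P ^ k) * \<Psi> 0) = laurent_frac (laurent_of_poly D * \<Psi> k)"
    by (simp add: frac_mult_power)
  also have "\<dots> = (\<Sum>j<n. laurent_of_poly (poly_digit P D j) * \<Psi> (k + j))"
    using frac_digit_sum[of n "poly_digit P D" k] poly_digit_below[OF degree_P]
      poly_eq_digit_sum[OF degree_P assms] by simp
  finally show ?thesis .
qed

locale P_expansion_finite = P_expansion P a \<Psi>
  for P :: "'f::{finite,field} poly" and a \<Psi>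
begin

text \<open>If \<open>h\<close> is the place of the leading \<open>P\<close>-adic digit of
  \<open>N\<close>, the norm of \<open>N\<close> is at least \<open>q ^ (degree P * h)\<close>, and
  one of the first \<open>h + c\<close> digits of the fractional part is nonzero, so its norm is at
  least \<open>q powi (- int (degree P * (h + c)))\<close>. The product is bounded below
  independently of \<open>N\<close> and \<open>k\<close>.\<close>

lemma Bad_P:
  assumes "hankel_nonsingular c a"
  shows "\<Psi> 0 \<in> Bad P"
proof -
  define q where "q = real CARD('f)"
  have q: "q > 1" using card_field_ge_2[where 'f = 'f] by (simp add: q_def)
  let ?s = "\<lambda>N k. laurent_norm (laurent_of_poly N) *
      laurent_norm (laurent_frac (laurent_of_poly (N * P ^ k) * \<Psi> 0))"
  have "q powi (- int (degree P * c)) \<le> ?s N k" if N: "N \<noteq> 0" for N k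
  proof -
    define h where "h = degree N div degree P"
    have h_le: "degree P * h \<le> degree N" by (simp add: h_def)
    have "degree N < degree P * Suc h"
      using degree_P by (simp add: h_def dividend_less_times_div)
    then have below: "N \<in> polys_below (degree P * Suc h)" by (simp add: polys_below_iff)
    have "poly_digit P N h \<noteq> 0"
    proof
      assume "poly_digit P N h = 0"
      then have "N = (\<Sum>j<h. poly_digit P N j * P ^ j)"
        using poly_eq_digit_sum[OF degree_P below] by simp
      also have "\<dots> \<in> polys_below (degree P * h)"
        by (intro digit_sum_below poly_digit_below degree_P)
      finally show False using N h_le by (simp add: polys_below_iff)
    qed
    \<comment> \<open>The Hankel matrix acts on each coefficient of the digits separately, so it
      suffices to follow one position \<open>s\<close> at which the leading digit is
      nonzero.\<close>
    then obtain s where s: "coeff (poly_digit P N h) s \<noteq> 0"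
      by (auto simp: poly_eq_iff)
    obtain i where i: "1 \<le> i" "i \<le> h + c" "(\<Sum>j\<le>h. coeff (poly_digit P N j) s * a (i + j + k)) \<noteq> 0"
      by (rule hankel_nonsingularD[OF assms, of h h "\<lambda>j. coeff (poly_digit P N j) s" k]) (use s in auto)
    have "\<not> vanishes_below (int (degree P * (h + c)) + 1) (laurent_frac (laurent_of_poly (N * P ^ k) * \<Psi> 0))"
    proof
      assume "vanishes_below (int (degree P * (h + c)) + 1) (laurent_frac (laurent_of_poly (N * P ^ k) * \<Psi> 0))"
      then have "vanishes_below (int (degree P * (h + c)) + 1)
          (\<Sum>j<Suc h. laurent_of_poly (poly_digit P N j) * \<Psi> (k + j))"
        by (simp only: digits_of_poly[OF below])
      then have "(\<Sum>j<Suc h. smult (a (Suc (k + j + (i - 1)))) (poly_digit P N j)) = 0"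
        by (rule frac_digits_vanish[rotated]) (use i degree_P poly_digit_below in auto)
      then have "coeff (\<Sum>j<Suc h. smult (a (Suc (k + j + (i - 1)))) (poly_digit P N j)) s = 0" by simp
      moreover have "Suc (k + j + (i - 1)) = i + j + k" for j using i(1) by simp
      ultimately show False using i(3) by (simp add: coeff_sum mult.commute lessThan_Suc_atMost add_ac)
    qed
    then have "q powi (- int (degree P * (h + c))) \<le> laurent_norm (laurent_frac (laurent_of_poly (N * P ^ k) * \<Psi> 0))"
      unfolding q_def by (rule laurent_norm_ge)
    moreover have "q ^ (degree P * h) \<le> laurent_norm (laurent_of_poly N)"
      using N h_le q by (simp add: laurent_norm_of_poly q_def[symmetric] power_increasing)
    ultimately have "q ^ (degree P * h) * q powi (- int (degree P * (h + c))) \<le> ?s N k"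
      by (intro mult_mono) (use q in auto)
    moreover have "q ^ (degree P * h) * q powi (- int (degree P * (h + c))) = q powi (- int (degree P * c))"
      using q unfolding distrib_left by (subst power_mult_power_int_minus) auto
    ultimately show ?thesis by simp
  qed
  moreover have "?s 1 0 \<in> {?s N k | N k. N \<noteq> 0}"
    by (rule CollectI, intro exI[of _ 1] exI[of _ 0]) simp
  ultimately have "q powi (- int (degree P * c)) \<le> Inf {?s N k | N k. N \<noteq> 0}"
    by (intro cInf_greatest) blast+
  moreover have "q powi (- int (degree P * c)) > 0" using q by simp
  ultimately have "0 < Inf {?s N k | N k. N \<noteq> 0}" by linarith
  then show ?thesis by (simp add: Bad_def)
qed

text \<open>Contains the differences of the polynomials of two numbers in a block of length
  \<open>b ^ J\<close> that share the first \<open>k\<close> base-\<open>b\<close> digits of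
  \<open>V\<close> and the first \<open>L\<close> of \<open>K\<close>.\<close>

definition digit_kernel :: "nat \<Rightarrow> nat \<Rightarrow> nat \<Rightarrow> 'f poly set" where
  "digit_kernel J k L = {D \<in> polys_below (degree P * J). P ^ k dvd D \<and>
     vanishes_below (int (degree P * L) + 1) (laurent_frac (laurent_of_poly D * \<Psi> 0))}"

lemma digit_kernel_diff:
  "D \<in> digit_kernel J k L \<Longrightarrow> D' \<in> digit_kernel J k L \<Longrightarrow> D - D' \<in> digit_kernel J k L"
  by (simp add: digit_kernel_def polys_below_diff laurent_of_poly.hom_minus left_diff_distrib
      laurent_frac_diff vanishes_below_diff)

text \<open>Two spaces independent of the kernel are exhibited: the remainders \<open>z\<close>
  modulo \<open>P ^ k\<close>, and multiples \<open>Q e * P ^ k\<close> whose fractional parts have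
  arbitrary leading digits \<open>e\<close>. Adding the three parts is injective into
  \<open>polys_below (degree P * J)\<close>, and comparing cardinalities bounds the kernel.\<close>

lemma card_digit_kernel_le:
  assumes "hankel_nonsingular c a" and J: "k + L + c \<le> J"
  shows "card (digit_kernel J k L) * (CARD('f) ^ degree P) ^ (k + L) \<le> (CARD('f) ^ degree P) ^ J"
proof -
  let ?d = "degree P"
  define n where "n = J - k"
  have J_eq: "J = k + n" using J by (simp add: n_def)
  have "L + c \<le> n" using J by (simp add: n_def)
  from hankel_dual_vectors[OF assms(1) this, of k] obtain v where
    v: "\<And>l i. l < L \<Longrightarrow> i < L \<Longrightarrow> (\<Sum>j<n. v i j * a (Suc (k + j + l))) = (if l = i then 1 else 0)"
    by blast
  define E where "E = PiE {..<L} (\<lambda>_. polys_below ?d :: 'f poly set)"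
  \<comment> \<open>The dual vectors solve the linear system for the digits: the \<open>l\<close>-th
    leading \<open>P\<close>-adic digit of the fractional part belonging to
    \<open>Q e * P ^ k\<close> is \<open>e l\<close>.\<close>
  define b where "b e j = (\<Sum>i<L. smult (v i j) (e i))" for e :: "nat \<Rightarrow> 'f poly" and j
  define Q where "Q e = (\<Sum>j<n. b e j * P ^ j)" for e
  define T where "T = (\<lambda>(D, z, e). D + z + Q e * P ^ k)"
  have b_diff: "b e j - b e' j = b (\<lambda>i. e i - e' i) j" for e e' j
    by (simp add: b_def sum_subtractf smult_diff_right)
  have Q_diff: "Q e - Q e' = Q (\<lambda>i. e i - e' i)" for e e'
    by (simp add: Q_def sum_subtractf left_diff_distrib flip: b_diff)
  have b_below: "b e j \<in> polys_below ?d" if "\<And>i. i < L \<Longrightarrow> e i \<in> polys_below ?d" for e j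
    unfolding b_def using that by (intro polys_below_sum) (auto simp: polys_below_def)
  have e_eq_0: "\<forall>l<L. e l = 0"
    if e: "\<And>i. i < L \<Longrightarrow> e i \<in> polys_below ?d" and D: "Q e * P ^ k \<in> digit_kernel J k L" for e
  proof (intro allI impI)
    fix l assume l: "l < L"
    have "laurent_frac (laurent_of_poly (Q e * P ^ k) * \<Psi> 0) = (\<Sum>j<n. laurent_of_poly (b e j) * \<Psi> (k + j))"
      unfolding frac_mult_power Q_def using b_below[OF e] by (subst frac_digit_sum) auto
    then have "(\<Sum>j<n. smult (a (Suc (k + j + l))) (b e j)) = 0"
      using D l b_below[OF e] by (intro frac_digits_vanish[where L = L]) (auto simp: digit_kernel_def)
    also have "(\<Sum>j<n. smult (a (Suc (k + j + l))) (b e j))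
        = (\<Sum>j<n. \<Sum>i<L. smult (v i j * a (Suc (k + j + l))) (e i))"
      by (simp add: b_def smult_sum2 mult.commute)
    also have "\<dots> = (\<Sum>i<L. smult (\<Sum>j<n. v i j * a (Suc (k + j + l))) (e i))"
      by (subst sum.swap) (simp add: smult_sum)
    also have "\<dots> = (\<Sum>i<L. if i = l then e i else 0)"
      using l by (intro sum.cong) (auto simp: v)
    finally show "e l = 0" using l by simp
  qed
  have deg_Pk: "degree (P ^ k) = ?d * k"
    using P_nonzero by (simp add: degree_power_eq)
  have "inj_on T (digit_kernel J k L \<times> polys_below (?d * k) \<times> E)"
  proof (rule inj_onI)
    fix x y
    assume xy: "x \<in> digit_kernel J k L \<times> polys_below (?d * k) \<times> E"
      "y \<in> digit_kernel J k L \<times> polys_below (?d * k) \<times> E" "T x = T y"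
    obtain D z e D' z' e' where xy_eq: "x = (D, z, e)" "y = (D', z', e')"
      by (cases x, cases y) auto
    have D: "D \<in> digit_kernel J k L" "D' \<in> digit_kernel J k L"
      and z: "z \<in> polys_below (?d * k)" "z' \<in> polys_below (?d * k)"
      and e: "e \<in> E" "e' \<in> E"
      using xy by (simp_all add: xy_eq)
    from xy(3) have eq: "D - D' + (z - z') = Q (\<lambda>i. e' i - e i) * P ^ k"
      by (simp add: xy_eq T_def algebra_simps flip: Q_diff)
    have DD: "D - D' \<in> digit_kernel J k L" using D by (rule digit_kernel_diff)
    \<comment> \<open>Modulo \<open>P ^ k\<close> only \<open>z - z'\<close> survives in
      \<open>eq\<close>, and its degree is too small for a nonzero multiple. What remains of
      \<open>eq\<close> puts the \<open>Q\<close> term into the kernel, so \<open>e_eq_0\<close>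
      applies.\<close>
    have "P ^ k dvd D - D'" using DD by (simp add: digit_kernel_def)
    moreover have "P ^ k dvd D - D' + (z - z')" unfolding eq by simp
    ultimately have "P ^ k dvd z - z'" using dvd_add_right_iff[of "P ^ k" "D - D'"] by simp
    moreover have "z - z' = 0 \<or> degree (z - z') < degree (P ^ k)"
      using polys_below_diff[OF z] by (simp add: polys_below_iff deg_Pk)
    ultimately have zz: "z - z' = 0" by (meson dvd_imp_degree_le not_less)
    have ei: "e i \<in> polys_below ?d" "e' i \<in> polys_below ?d" if "i < L" for i
      using e that by (auto simp: E_def PiE_iff)
    have "Q (\<lambda>i. e' i - e i) * P ^ k \<in> digit_kernel J k L"
      using DD eq zz by simp
    then have "\<forall>l<L. e' l - e l = 0"
      by (rule e_eq_0[rotated]) (rule polys_below_diff[OF ei(2,1)])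
    moreover from this have "Q (\<lambda>i. e' i - e i) = 0"
      by (simp add: Q_def b_def)
    moreover from this have "D = D'" "z = z'" using zz eq by simp_all
    moreover have "e = e'"
    proof (rule PiE_ext)
      show "e \<in> PiE {..<L} (\<lambda>_. polys_below ?d)" "e' \<in> PiE {..<L} (\<lambda>_. polys_below ?d)"
        using e by (simp_all only: E_def)
    qed (use \<open>\<forall>l<L. e' l - e l = 0\<close> in simp)
    ultimately show "x = y" by (simp add: xy_eq)
  qed
  moreover have "T ` (digit_kernel J k L \<times> polys_below (?d * k) \<times> E) \<subseteq> polys_below (?d * J)"
  proof clarify
    fix D z :: "'f poly" and e assume D: "D \<in> digit_kernel J k L" and z: "z \<in> polys_below (?d * k)" and e: "e \<in> E"
    have "Q e \<in> polys_below (?d * n)"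
      unfolding Q_def using e by (intro digit_sum_below b_below) (auto simp: E_def PiE_iff)
    then have "Q e * P ^ k \<in> polys_below (?d * n + ?d * k)"
      by (rule polys_below_mult) (simp add: deg_Pk)
    moreover have "?d * n + ?d * k = ?d * J" by (simp add: J_eq algebra_simps)
    moreover have "z \<in> polys_below (?d * J)"
      using z by (rule polys_below_mono) (simp add: J_eq)
    ultimately show "T (D, z, e) \<in> polys_below (?d * J)"
      using D unfolding T_def by (auto intro!: polys_below_add simp: digit_kernel_def)
  qed
  ultimately have "card (digit_kernel J k L \<times> (polys_below (?d * k) :: 'f poly set) \<times> E) \<le> card (polys_below (?d * J) :: 'f poly set)"
    by (rule card_inj_on_le) simp
  moreover have "card E = (CARD('f) ^ ?d) ^ L"
    by (simp add: E_def card_PiE card_polys_below)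
  ultimately show ?thesis
    by (simp only: card_cartesian_product card_polys_below power_add power_mult)
qed

end

section \<open>Evaluation of digits\<close>

text \<open>Makes \<open>E\<close> a bijection onto the base-q digits; \<open>E_0\<close> lets the
  leading zeros of a number become zero coefficients.\<close>

locale digit_evaluation =
  fixes E :: "'f::{finite,field} \<Rightarrow> nat"
  assumes inj_E: "inj E" and E_less: "\<And>x. E x < CARD('f)" and E_0 [simp]: "E 0 = 0"
begin

lemma range_E: "range E = {..<CARD('f)}"
  by (rule card_subset_eq) (use E_less in \<open>auto simp: card_image inj_E\<close>)

lemma E_inv: "x < CARD('f) \<Longrightarrow> E (inv_into UNIV E x) = x"
  by (rule f_inv_into_f) (simp add: range_E)

lemma inv_E_0: "inv_into UNIV E 0 = 0"
  using inv_f_f[OF inj_E, of 0] by simp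

text \<open>The cut-off at \<open>n\<close> in \<open>assoc_poly\<close> loses nothing: for
  \<open>n < i\<close> the digit at \<open>i\<close> is 0, and so is its preimage under
  \<open>E\<close>.\<close>

lemma coeff_assoc_poly: "coeff (assoc_poly E n) i = inv_into UNIV E (n div CARD('f) ^ i mod CARD('f))"
proof -
  have "coeff (assoc_poly E n) i = (if i \<le> n then inv_into UNIV E (n div CARD('f) ^ i mod CARD('f)) else 0)"
    by (simp add: assoc_poly_def coeff_sum sum.delta)
  moreover have "n div CARD('f) ^ i = 0" if "n < i"
  proof -
    have "n < 2 ^ n" by (rule less_exp)
    also have "\<dots> \<le> CARD('f) ^ n" by (intro power_mono card_field_ge_2) simp
    also have "\<dots> \<le> CARD('f) ^ i" using that card_field_ge_2[where 'f = 'f] by (intro power_increasing) auto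
    finally show ?thesis by simp
  qed
  ultimately show ?thesis by (auto simp: inv_E_0)
qed

lemma inj_assoc_poly: "inj (assoc_poly E)"
proof (rule injI)
  fix x y assume eq: "assoc_poly E x = assoc_poly E y"
  have "x div CARD('f) ^ i mod CARD('f) = y div CARD('f) ^ i mod CARD('f)" for i
  proof -
    have "inv_into UNIV E (x div CARD('f) ^ i mod CARD('f)) = inv_into UNIV E (y div CARD('f) ^ i mod CARD('f))"
      using eq coeff_assoc_poly by metis
    then show ?thesis using E_inv by (metis mod_less_divisor zero_less_card_finite)
  qed
  then show "x = y" by (rule nat_eq_of_digits_eq[OF card_field_ge_2])
qed

text \<open>Numbers in one block have the same quotient \<open>s\<close>, hence the same digits from
  place \<open>m\<close> on.\<close>

lemma assoc_poly_block:
  assumes "x \<in> {s * CARD('f) ^ m..<Suc s * CARD('f) ^ m}" "y \<in> {s * CARD('f) ^ m..<Suc s * CARD('f) ^ m}"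
  shows "assoc_poly E x - assoc_poly E y \<in> polys_below m"
proof -
  have "x div CARD('f) ^ m = s" "y div CARD('f) ^ m = s"
    using assms by (auto intro!: div_nat_eqI simp: mult.commute)
  then have "x div CARD('f) ^ i = y div CARD('f) ^ i" if "i \<ge> m" for i
    using that by (metis div_mult2_eq le_add_diff_inverse power_add)
  then show ?thesis by (simp add: polys_below_def coeff_assoc_poly)
qed

definition poly_value :: "nat \<Rightarrow> 'f poly \<Rightarrow> nat" where
  "poly_value d f = (\<Sum>i<d. E (coeff f i) * CARD('f) ^ i)"

lemma poly_value_less: "poly_value d f < CARD('f) ^ d"
  unfolding poly_value_def by (rule digit_sum_less) (rule E_less)

lemma poly_value_eqD:
  assumes "poly_value d f = poly_value d g" "f \<in> polys_below d" "g \<in> polys_below d"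
  shows "f = g"
proof (rule poly_eqI)
  fix i
  show "coeff f i = coeff g i"
  proof (cases "i < d")
    case True
    have "E (coeff f i) = E (coeff g i)"
      by (rule digit_sum_eqD[OF E_less E_less assms(1)[unfolded poly_value_def] True])
    then show ?thesis using inj_E by (simp add: inj_eq)
  qed (use assms(2,3) in \<open>simp add: polys_below_def\<close>)
qed

lemma laurent_eval_poly:
  assumes "f \<in> polys_below d"
  shows "laurent_eval E (laurent_of_poly f) = real (poly_value d f)"
proof -
  let ?g = "\<lambda>i. real (E (fls_nth (laurent_of_poly f) i)) * real CARD('f) powi (- i)"
  let ?h = "\<lambda>s. - int s"
  have "infsum ?g {fls_subdegree (laurent_of_poly f)..} = infsum ?g (?h ` {..<d})"
  proof (rule infsum_cong_neutral)
    fix i assume i: "i \<in> {fls_subdegree (laurent_of_poly f)..} - ?h ` {..<d}"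
    have "fls_nth (laurent_of_poly f) i = 0"
    proof (cases "i \<le> 0")
      case True
      then have "i = ?h (nat (- i))" by simp
      then have "\<not> nat (- i) < d" using i by blast
      then show ?thesis using assms by (simp add: laurent_of_poly_nth polys_below_def)
    qed (simp add: laurent_of_poly_nth)
    then show "?g i = 0" by simp
  qed (auto simp: fls_eq0_below_subdegree)
  also have "\<dots> = sum ?g (?h ` {..<d})" by simp
  also have "\<dots> = (\<Sum>s<d. ?g (- int s))"
    by (subst sum.reindex) (auto simp: inj_on_def)
  also have "\<dots> = real (poly_value d f)"
    by (simp add: poly_value_def laurent_of_poly_nth)
  finally show ?thesis by (simp add: laurent_eval_def)
qed

text \<open>The sum in \<open>laurent_eval\<close> starts at the subdegree, which varies with
  \<open>f\<close>. Since zero coefficients have value 0, its range may be exchanged for the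
  positive indices.\<close>

lemma laurent_eval_frac:
  assumes "vanishes_below 1 f"
  shows "laurent_eval E f = (\<Sum>i. real (E (fls_nth f (int i + 1))) / real CARD('f) ^ (i + 1))"
proof -
  let ?g = "\<lambda>i. real (E (fls_nth f i)) * real CARD('f) powi (- i)"
  let ?h = "\<lambda>i. int i + 1"
  let ?t = "\<lambda>i. real (E (fls_nth f (int i + 1))) / real CARD('f) ^ (i + 1)"
  have "infsum ?g {fls_subdegree f..} = infsum ?g (range ?h)"
  proof (rule infsum_cong_neutral)
    fix i assume i: "i \<in> {fls_subdegree f..} - range ?h"
    have "\<not> i \<ge> 1"
    proof
      assume "i \<ge> 1"
      then have "i = ?h (nat (i - 1))" by simp
      then show False using i by blast
    qed
    then show "?g i = 0" using assms by (simp add: vanishes_below_def)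
  qed (auto simp: fls_eq0_below_subdegree)
  also have "\<dots> = infsum (?g \<circ> ?h) UNIV"
    by (rule infsum_reindex) (auto simp: inj_on_def)
  also have "?g \<circ> ?h = ?t"
  proof
    fix i
    have "real CARD('f) powi (- int (i + 1)) = 1 / real CARD('f) ^ (i + 1)"
      by (simp only: power_int_minus power_int_of_nat inverse_eq_divide)
    moreover have "int (i + 1) = int i + 1" by simp
    ultimately have "real CARD('f) powi (- (int i + 1)) = 1 / real CARD('f) ^ (i + 1)"
      by (simp only:)
    then show "(?g \<circ> ?h) i = ?t i" by (simp only: o_apply) simp
  qed
  also have "infsum ?t UNIV = suminf ?t"
  proof -
    have "summable ?t"
      using prefix_value_summable[of "\<lambda>i. E (fls_nth f (int i + 1))"] E_less by simp
    then have "(?t has_sum suminf ?t) UNIV"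
      by (intro sums_nonneg_imp_has_sum summable_sums) auto
    then show ?thesis by (rule infsumI)
  qed
  finally show ?thesis by (simp add: laurent_eval_def)
qed

end

section \<open>The evaluation function of the finite field\<close>

lemma Fq_rep_unique:
  fixes m :: "'p::prime_card mod_ring poly" and \<phi> :: "'p mod_ring poly \<Rightarrow> 'f::{finite,field}"
  assumes "Fq_quotient m \<phi>"
  shows "degree m > 0" "\<exists>!f. degree f < degree m \<and> \<phi> f = c"
proof -
  have irr: "irreducible m" and hom: "comm_ring_hom \<phi>" and surj: "surj \<phi>"
    and ker: "\<And>f. \<phi> f = 0 \<longleftrightarrow> m dvd f"
    using assms by (auto simp: Fq_quotient_def)
  interpret comm_ring_hom \<phi> by (rule hom)
  show deg: "degree m > 0"
    using irr is_unit_iff_degree[of m] unfolding irreducible_def by auto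
  obtain g where g: "\<phi> g = c" using surj by (metis surjD)
  have "\<phi> g = \<phi> (m * (g div m)) + \<phi> (g mod m)"
    by (simp flip: hom_add)
  moreover have "\<phi> (m * (g div m)) = 0" by (simp add: ker)
  ultimately have "\<phi> (g mod m) = c" using g by simp
  moreover have "degree (g mod m) < degree m"
  proof -
    have "m \<noteq> 0" using deg by auto
    then show ?thesis using degree_mod_less[of m g] deg by auto
  qed
  moreover have "f = f'" if f: "degree f < degree m" "\<phi> f = c" "degree f' < degree m" "\<phi> f' = c" for f f'
  proof (rule ccontr)
    assume "f \<noteq> f'"
    have "\<phi> (f - f') = 0" using f by (simp add: hom_minus)
    then have "m dvd f - f'" by (simp add: ker)
    then have "degree m \<le> degree (f - f')" using \<open>f \<noteq> f'\<close> by (intro dvd_imp_degree_le) auto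
    then show False using degree_diff_less[OF f(1,3)] by simp
  qed
  ultimately show "\<exists>!f. degree f < degree m \<and> \<phi> f = c" by blast
qed

text \<open>\<open>Fq_eval\<close> reads the coefficients of the representative as base-p digits of
  a number below \<open>p ^ degree m\<close>. This power is at most q, because \<phi> is injective
  on the representatives.\<close>

lemma Fq_eval_digit_evaluation:
  fixes m :: "'p::prime_card mod_ring poly" and \<phi> :: "'p mod_ring poly \<Rightarrow> 'f::{finite,field}"
  assumes Fq: "Fq_quotient m \<phi>"
  shows "digit_evaluation (Fq_eval m \<phi>)"
proof -
  let ?p = "CARD('p)"
  let ?n = "degree m"
  have rep: "degree (Fq_rep m \<phi> c) < ?n" "\<phi> (Fq_rep m \<phi> c) = c" for c
    using theI'[OF Fq_rep_unique(2)[OF Fq, of c]] unfolding Fq_rep_def by auto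
  have repI: "Fq_rep m \<phi> (\<phi> f) = f" if "degree f < ?n" for f
    using Fq_rep_unique(2)[OF Fq, of "\<phi> f"] rep[of "\<phi> f"] that by blast
  define \<delta> where "\<delta> x = nat (to_int_mod_ring x)" for x :: "'p mod_ring"
  have range: "0 \<le> to_int_mod_ring x" "to_int_mod_ring x < int ?p" for x :: "'p mod_ring"
    using range_to_int_mod_ring[where 'a = 'p] by auto
  have \<delta>: "int (\<delta> x) = to_int_mod_ring x" "\<delta> x < ?p" for x
    using range[of x] by (auto simp: \<delta>_def)
  have eval: "Fq_eval m \<phi> c = (\<Sum>i<?n. \<delta> (coeff (Fq_rep m \<phi> c) i) * ?p ^ i)" for c
  proof -
    let ?f = "Fq_rep m \<phi> c"
    have "poly (map_poly to_int_mod_ring ?f) (int ?p) = (\<Sum>i\<le>degree ?f. to_int_mod_ring (coeff ?f i) * int ?p ^ i)"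
      by (simp add: poly_altdef)
    also have "\<dots> = (\<Sum>i<?n. to_int_mod_ring (coeff ?f i) * int ?p ^ i)"
      using rep(1)[of c] by (intro sum.mono_neutral_left) (auto simp: coeff_eq_0)
    also have "\<dots> = int (\<Sum>i<?n. \<delta> (coeff ?f i) * ?p ^ i)"
      by (simp add: \<delta>(1))
    finally show ?thesis unfolding Fq_eval_def by (simp only: nat_int)
  qed
  have "inj_on \<phi> (polys_below ?n)"
  proof (rule inj_onI)
    fix f g assume "f \<in> polys_below ?n" "g \<in> polys_below ?n" "\<phi> f = \<phi> g"
    then show "f = g" using repI Fq_rep_unique(1)[OF Fq] by (metis degree_0 polys_below_iff)
  qed
  then have "card (polys_below ?n :: 'p mod_ring poly set) \<le> CARD('f)"
    by (intro card_inj_on_le[of \<phi>]) auto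
  then have card: "?p ^ ?n \<le> CARD('f)"
    by (simp add: card_polys_below CARD_mod_ring)
  show ?thesis
  proof
    show "inj (Fq_eval m \<phi>)"
    proof (rule injI)
      fix x y assume eq: "Fq_eval m \<phi> x = Fq_eval m \<phi> y"
      have "coeff (Fq_rep m \<phi> x) i = coeff (Fq_rep m \<phi> y) i" for i
      proof (cases "i < ?n")
        case True
        have "\<delta> (coeff (Fq_rep m \<phi> x) i) = \<delta> (coeff (Fq_rep m \<phi> y) i)"
          by (rule digit_sum_eqD[OF \<delta>(2) \<delta>(2) eq[unfolded eval] True])
        then show ?thesis by (metis \<delta>(1) to_int_mod_ring_hom.injectivity)
      next
        case False
        then show ?thesis using rep(1)[of x] rep(1)[of y] by (simp add: coeff_eq_0)
      qed
      then have "Fq_rep m \<phi> x = Fq_rep m \<phi> y" by (simp add: poly_eq_iff)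
      then show "x = y" using rep(2) by metis
    qed
    show "Fq_eval m \<phi> x < CARD('f)" for x
      using digit_sum_less[OF \<delta>(2), of "coeff (Fq_rep m \<phi> x)" ?n] card by (simp add: eval)
    have "\<phi> 0 = 0" using Fq by (auto simp: Fq_quotient_def)
    then have "Fq_rep m \<phi> 0 = 0" using repI[of 0] Fq_rep_unique(1)[OF Fq] by simp
    then show "Fq_eval m \<phi> 0 = 0" by (simp add: eval \<delta>_def)
  qed
qed

section \<open>The hybrid sequence\<close>

lemma hybrid_block_discrepancy:
  fixes P :: "'f::{finite,field} poly"
  assumes "digit_evaluation E" "P_expansion P a \<Psi>" and hankel: "hankel_nonsingular c a"
    and b_def: "b = CARD('f) ^ degree P"
    and I: "is_interval I" "I \<subseteq> {0..<1}" and I': "is_interval I'" "I' \<subseteq> {0..<1}"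
  shows "\<bar>real (card {n\<in>{s * b ^ J..<Suc s * b ^ J}. hybrid E (\<Psi> 0) P n \<in> I \<times> I'})
            - real b ^ J * measure lborel (I \<times> I')\<bar> \<le> 9 * real b ^ (c + 1) * real (J + 1)"
proof -
  interpret digit_evaluation E by fact
  interpret P_expansion_finite P a \<Psi>
    using assms(2) by (simp add: P_expansion_finite_def)
  let ?q = "CARD('f)" and ?d = "degree P"
  let ?S = "{s * b ^ J..<Suc s * b ^ J}"
  have q0: "?q > 0" by simp
  have b1: "b \<ge> 1" unfolding b_def using q0 by (simp add: Suc_le_eq)
  have b_pow: "b ^ k = ?q ^ (?d * k)" for k by (simp add: b_def power_mult)
  define A where "A = assoc_poly E"
  define F where "F n = laurent_frac (laurent_of_poly (A n) * \<Psi> 0)" for n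
  define \<delta>V where "\<delta>V n i = poly_value ?d (poly_digit P (A n) i)" for n i
  define \<delta>K where "\<delta>K n i = E (fls_nth (F n) (int i + 1))" for n i
  \<comment> \<open>One base-\<open>b\<close> digit of \<open>V\<close> comes from one
    \<open>P\<close>-adic digit of \<open>n(t)\<close>, whereas one of \<open>K\<close> is a group
    of \<open>degree P\<close> base-q digits. Both prefixes name cells of length
    \<open>1 / b ^ k\<close>.\<close>
  define X where "X k n = prefix_value b (\<delta>V n) k" for k n
  define Y where "Y k n = prefix_value ?q (\<delta>K n) (?d * k)" for k n
  have \<delta>V_less: "\<delta>V n i < b" for n i by (simp add: \<delta>V_def b_def poly_value_less)
  have \<delta>K_less: "\<delta>K n i < ?q" for n i by (simp add: \<delta>K_def E_less)
  have V: "van_der_corput E P n = (\<Sum>i. real (\<delta>V n i) / real b ^ (i + 1))" for n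
    unfolding van_der_corput_def \<delta>V_def A_def
    by (simp only: laurent_eval_poly[OF poly_digit_below[OF degree_P]] laurent_norm_of_poly[OF P_nonzero] b_def of_nat_power)
  have F1: "vanishes_below 1 (F n)" for n
    by (simp add: F_def vanishes_below_def laurent_frac_nth)
  have K: "kronecker E (\<Psi> 0) n = (\<Sum>i. real (\<delta>K n i) / real ?q ^ (i + 1))" for n
    unfolding kronecker_def A_def[symmetric] F_def[symmetric] \<delta>K_def by (rule laurent_eval_frac[OF F1])
  \<comment> \<open>Subtracting the polynomial of one member \<open>n0\<close> embeds the fibre into
    the digit kernel.\<close>
  have fibre: "card {n\<in>?S. (X k n, Y L n) = y} \<le> b ^ c" if kL: "k + L + c = J" for k L y
  proof (cases "{n\<in>?S. (X k n, Y L n) = y} = {}")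
    case False
    then obtain n0 where n0: "n0 \<in> ?S" "(X k n0, Y L n0) = y" by blast
    have "A n - A n0 \<in> digit_kernel J k L" if n: "n \<in> ?S" "(X k n, Y L n) = y" for n
    proof -
      have XY: "X k n = X k n0" "Y L n = Y L n0" using n n0 by auto
      have "poly_digit P (A n) i = poly_digit P (A n0) i" if "i < k" for i
      proof -
        have "\<delta>V n i = \<delta>V n0 i"
          by (rule prefix_value_eqD[OF \<delta>V_less \<delta>V_less XY(1)[unfolded X_def] that])
        then show ?thesis
          unfolding \<delta>V_def by (rule poly_value_eqD) (intro poly_digit_below degree_P)+
      qed
      then have "P ^ k dvd A n - A n0" by (rule dvd_diff_of_digits_eq)
      moreover have "A n - A n0 \<in> polys_below (?d * J)"
        unfolding A_def using n n0 by (intro assoc_poly_block[of _ s]) (simp_all only: b_pow)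
      \<comment> \<open>Digit \<open>i\<close> of \<open>K\<close> is the coefficient at
        \<open>i + 1\<close>, so \<open>?d * L\<close> common digits give vanishing below
        \<open>?d * L + 1\<close>.\<close>
      moreover have "vanishes_below (int (?d * L) + 1) (F n - F n0)"
        unfolding vanishes_below_def
      proof (intro allI impI)
        fix j assume j: "j < int (?d * L) + 1"
        show "fls_nth (F n - F n0) j = 0"
        proof (cases "j \<ge> 1")
          case True
          define i where "i = nat (j - 1)"
          have i_eq: "j = int i + 1" using True by (simp add: i_def)
          then have "int i < int (?d * L)" using j by linarith
          then have i: "j = int i + 1" "i < ?d * L" using i_eq by (simp_all only: of_nat_less_iff)
          have "\<delta>K n i = \<delta>K n0 i"
            by (rule prefix_value_eqD[OF \<delta>K_less \<delta>K_less XY(2)[unfolded Y_def] i(2)])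
          then have "fls_nth (F n) j = fls_nth (F n0) j"
            using inj_E by (simp add: \<delta>K_def i(1) inj_eq)
          then show ?thesis by simp
        next
          case False
          then show ?thesis by (simp add: F_def laurent_frac_nth)
        qed
      qed
      ultimately show ?thesis
        by (simp add: digit_kernel_def F_def laurent_of_poly.hom_minus left_diff_distrib laurent_frac_diff)
    qed
    then have "(\<lambda>n. A n - A n0) ` {n\<in>?S. (X k n, Y L n) = y} \<subseteq> digit_kernel J k L" by blast
    moreover have "inj_on (\<lambda>n. A n - A n0) {n\<in>?S. (X k n, Y L n) = y}"
      using inj_assoc_poly by (auto simp: A_def inj_on_def)
    moreover have "finite (digit_kernel J k L)"
      by (rule finite_subset[OF _ finite_polys_below[of "?d * J"]]) (auto simp: digit_kernel_def)
    ultimately have "card {n\<in>?S. (X k n, Y L n) = y} \<le> card (digit_kernel J k L)"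
      by (intro card_inj_on_le)
    also have "\<dots> \<le> b ^ c"
    proof -
      have "card (digit_kernel J k L) * b ^ (k + L) \<le> b ^ J"
        using card_digit_kernel_le[OF hankel, of k L J] kL by (simp add: b_def)
      also have "b ^ J = b ^ c * b ^ (k + L)" by (simp flip: kL power_add add: add_ac)
      finally show ?thesis using b1 by simp
    qed
    finally show ?thesis .
  next
    case True
    show ?thesis unfolding True by simp
  qed
  have card_S: "card ?S = b ^ J" by simp
  have net: "card {n\<in>?S. X k n = x \<and> Y L n = y} = b ^ c"
    if "k + L + c = J" "x < b ^ k" "y < b ^ L" for k L x y
  proof -
    have "card {n\<in>?S. (X k n, Y L n) = (x, y)} = b ^ c"
    \<comment> \<open>The \<open>b ^ J\<close> numbers fall into \<open>b ^ (k + L)\<close> cells,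
      so the bound \<open>b ^ c\<close> must be attained in each.\<close>
    proof (rule card_fibre_eq[where T = "{..<b ^ k} \<times> {..<b ^ L}"])
      show "(\<lambda>n. (X k n, Y L n)) ` ?S \<subseteq> {..<b ^ k} \<times> {..<b ^ L}"
        using prefix_value_less[OF \<delta>V_less] prefix_value_less[OF \<delta>K_less]
        by (auto simp: X_def Y_def b_pow[of L])
      show "card ?S = card ({..<b ^ k} \<times> {..<b ^ L}) * b ^ c"
        unfolding card_S by (simp add: card_cartesian_product flip: that(1) power_add)
      show "card {n\<in>?S. (X k n, Y L n) = y} \<le> b ^ c" for y
        by (rule fibre[OF that(1)])
    qed (use that in auto)
    then show ?thesis by simp
  qed
  have q_pow: "real ?q ^ (?d * k) = real b ^ k" for k
    by (simp only: b_pow flip: of_nat_power)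
  have "\<bar>real (card {n\<in>?S. kronecker E (\<Psi> 0) n \<in> I \<and> van_der_corput E P n \<in> I'})
      - real b ^ J * (measure lborel I * measure lborel I')\<bar> \<le> 9 * real b ^ (c + 1) * real (J + 1)"
  proof (rule net_discrepancy[where X = X and Y = Y, OF _ card_S b1 _ _ _ _ _ _ _ net I I'])
    show "X k n < b ^ k" for k n unfolding X_def by (rule prefix_value_less[OF \<delta>V_less])
    show "X (Suc k) n div b = X k n" for k n unfolding X_def by (rule prefix_value_div[OF \<delta>V_less])
    show "real (X k n) \<le> van_der_corput E P n * real b ^ k" for k n
      unfolding X_def V by (rule prefix_value_le[OF \<delta>V_less])
    show "van_der_corput E P n * real b ^ k \<le> real (X k n) + 1" for k n
      unfolding X_def V by (rule prefix_value_ge[OF \<delta>V_less])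
    show "Y k n < b ^ k" for k n unfolding Y_def b_pow by (rule prefix_value_less[OF \<delta>K_less])
    show "real (Y k n) \<le> kronecker E (\<Psi> 0) n * real b ^ k" for k n
      unfolding Y_def K q_pow[symmetric] by (rule prefix_value_le[OF \<delta>K_less])
    show "kronecker E (\<Psi> 0) n * real b ^ k \<le> real (Y k n) + 1" for k n
      unfolding Y_def K q_pow[symmetric] by (rule prefix_value_ge[OF \<delta>K_less])
  qed auto
  then show ?thesis
    by (simp add: hybrid_def measure_lborel_Times I(1) I'(1) conj_commute)
qed

text \<open>Take \<open>i = n + 1\<close> with \<open>n\<close> the integer part of the logarithm of
  \<open>N\<close> to base \<open>b\<close>. Since \<open>b \<ge> 2\<close>, \<open>n\<close> is at
  most \<open>ln N / ln 2\<close>; since \<open>N \<ge> 2\<close>, so is 1, which yields the factor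
  2.\<close>

lemma ln_power_bound:
  fixes b N :: nat
  assumes "b \<ge> 2" "N \<ge> 2"
  obtains i where "N < b ^ i" "real i \<le> 2 / ln 2 * ln (real N)"
proof -
  obtain n where n: "b ^ n \<le> N" "N < b ^ (n + 1)"
    using ex_power_ivl1[of b N] assms by auto
  have "2 ^ n \<le> N" using power_mono[OF assms(1), of n] n(1) by linarith
  then have "real (2 ^ n) \<le> real N" by (simp only: of_nat_le_iff)
  then have "ln (real (2 ^ n)) \<le> ln (real N)" using assms(2) by (subst ln_le_cancel_iff) auto
  then have "real n * ln 2 \<le> ln (real N)" by (simp add: ln_realpow)
  moreover have "ln 2 \<le> ln (real N)" using assms(2) by simp
  ultimately have "real (n + 1) * ln 2 \<le> 2 * ln (real N)" by (simp add: distrib_right)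
  then have "real (n + 1) \<le> 2 / ln 2 * ln (real N)" by (simp add: pos_le_divide_eq)
  with n(2) show thesis by (rule that)
qed

theorem theorem1p5:
  fixes m :: "'p::prime_card mod_ring poly"
    and \<phi> :: "'p mod_ring poly \<Rightarrow> 'f::{finite,field}"
    and P :: "'f poly"
    and a :: "nat \<Rightarrow> 'f"
    and \<Theta> \<Phi> :: "'f fls"
  assumes "Fq_quotient m \<phi>"
    and "Factorial_Ring.irreducible P"
    and "\<Theta> = (\<Sum>i. fls_const (a (i + 1)) / laurent_t ^ (i + 1))"
    and "\<Theta> \<in> Bad [:0, 1:]"
    and "\<Phi> = (\<Sum>i. fls_const (a (i + 1)) / laurent_of_poly P ^ (i + 1))"
  shows "\<Phi> \<in> Bad P \<and>
    (\<exists>C>0. \<forall>N\<ge>2. discrepancy (hybrid (Fq_eval m \<phi>) \<Phi> P) N \<le> C * (ln (real N))\<^sup>2 / real N)"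
proof -
  have eval: "digit_evaluation (Fq_eval m \<phi>)"
    using assms(1) by (rule Fq_eval_digit_evaluation)
  have deg: "degree P \<ge> 1"
    using assms(2) is_unit_iff_degree[of P] unfolding Factorial_Ring.irreducible_def by (auto simp: Suc_le_eq)
  \<comment> \<open>\<Theta> is itself an expansion of this kind, in powers of \<open>t\<close>.
    Multiplication by \<open>t\<close> only shifts coefficients, so the recursion identifies those
    of \<Theta> with the values of \<open>a\<close>.\<close>
  obtain \<Psi>t where \<Psi>t: "P_expansion [:0, 1:] a \<Psi>t" "\<Psi>t 0 = \<Theta>"
    using P_expansion_exists[of "[:0, 1 :: 'f:]" a] unfolding assms(3) laurent_of_t by auto
  interpret t: P_expansion "[:0, 1:]" a \<Psi>t by (rule \<Psi>t(1))
  have "fls_nth (\<Psi>t j) (int i + 1) = a (Suc (j + i))" for i j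
  proof (induction i arbitrary: j)
    case (0 j)
    have "fls_nth (\<Psi>t (Suc j)) 0 = 0" using t.vanishes[of "Suc j"] by (simp add: vanishes_below_def)
    then have "fls_nth (laurent_of_poly [:0, 1:] * \<Psi>t j) 0 = a (Suc j)" unfolding t.shift by simp
    then show ?case by (simp add: laurent_of_t fls_X_inv_times_conv_shift)
  next
    case (Suc i j)
    have "fls_nth (laurent_of_poly [:0, 1:] * \<Psi>t j) (int i + 1) = a (Suc (Suc j + i))"
      unfolding t.shift by (simp add: Suc.IH)
    then show ?case by (simp add: laurent_of_t fls_X_inv_times_conv_shift add_ac)
  qed
  from this[of 0] have nth: "fls_nth \<Theta> (int i) = a i" if "i \<ge> 1" for i
    using that \<Psi>t(2) by (cases i) (auto simp: add_ac)
  obtain c where c: "hankel_nonsingular c a"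
    using Bad_t_hankel_nonsingular[OF assms(4) nth] by blast
  obtain \<Psi> where \<Psi>: "P_expansion P a \<Psi>" "\<Psi> 0 = \<Phi>"
    using P_expansion_exists[OF deg, of a] unfolding assms(5) by auto
  interpret P_expansion_finite P a \<Psi> using \<Psi>(1) by (simp add: P_expansion_finite_def)
  define b where "b = CARD('f) ^ degree P"
  have b: "b \<ge> 2"
    using card_field_ge_2[where 'f = 'f] power_increasing[of 1 "degree P" "CARD('f)"] deg by (simp add: b_def)
  \<comment> \<open>\<open>C1\<close> is the constant of a single block;
    \<open>(2 / ln 2)\<^sup>2\<close> comes from squaring the bound on the number of digits of
    \<open>N\<close>. Neither depends on \<open>N\<close> or on the box.\<close>
  define C1 where "C1 = 9 * real b ^ (c + 1)"
  define C where "C = real b * C1 * (2 / ln 2)\<^sup>2"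
  have C1: "C1 > 0" using b by (simp add: C1_def)
  have C: "C > 0" using b C1 by (simp add: C_def)
  let ?H = "hybrid (Fq_eval m \<phi>) \<Phi> P"
  have "discrepancy ?H N \<le> C * (ln (real N))\<^sup>2 / real N" if N: "N \<ge> 2" for N
    unfolding discrepancy_def
  proof (rule cSUP_least)
    show "boxes \<noteq> {}" unfolding boxes_def using is_interval_empty by blast
    fix B assume "B \<in> boxes"
    then obtain I I' where B: "B = I \<times> I'" "is_interval I" "I \<subseteq> {0..<1}" "is_interval I'" "I' \<subseteq> {0..<1}"
      unfolding boxes_def by blast
    obtain i where i: "N < b ^ i" "real i \<le> 2 / ln 2 * ln (real N)"
      using ln_power_bound[OF b N] .
    have block: "\<bar>real (card {n\<in>{s * b ^ J..<Suc s * b ^ J}. n \<in> {n. ?H n \<in> B}})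
        - real b ^ J * measure lborel B\<bar> \<le> C1 * real (J + 1)" for s J
      using hybrid_block_discrepancy[OF eval \<Psi>(1) c b_def B(2-5), of s J]
      unfolding \<Psi>(2) B(1) C1_def by simp
    \<comment> \<open>At scale \<open>J = 0\<close> the blocks are those given by the
      base-\<open>b\<close> digits of \<open>N\<close> itself.\<close>
    have "\<bar>real (card {n. n < b ^ 0 * N \<and> n \<in> {n. ?H n \<in> B}}) - real (b ^ 0 * N) * measure lborel B\<bar>
        \<le> real i * real b * C1 * real (0 + i)"
      using C1 by (intro block_count_bound[OF _ block i(1)]) simp
    also have "\<dots> = real b * C1 * (real i)\<^sup>2" by (simp add: power2_eq_square)
    also have "\<dots> \<le> real b * C1 * (2 / ln 2 * ln (real N))\<^sup>2"
      using C1 i(2) by (intro mult_left_mono power_mono) auto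
    also have "\<dots> = C * (ln (real N))\<^sup>2" by (simp add: C_def power_mult_distrib power_divide)
    finally have le: "\<bar>real (card {n. n < N \<and> ?H n \<in> B}) - real N * measure lborel B\<bar> \<le> C * (ln (real N))\<^sup>2"
      by simp
    have "real (card {n. n < N \<and> ?H n \<in> B}) / real N - measure lborel B
        = (real (card {n. n < N \<and> ?H n \<in> B}) - real N * measure lborel B) / real N"
      using N by (simp add: diff_divide_distrib)
    then have "\<bar>real (card {n. n < N \<and> ?H n \<in> B}) / real N - measure lborel B\<bar>
        = \<bar>real (card {n. n < N \<and> ?H n \<in> B}) - real N * measure lborel B\<bar> / real N"
      by simp
    also have "\<dots> \<le> C * (ln (real N))\<^sup>2 / real N"
      using le by (intro divide_right_mono) auto
    finally show "\<bar>real (card {n. n < N \<and> ?H n \<in> B}) / real N - measure lborel B\<bar>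
      \<le> C * (ln (real N))\<^sup>2 / real N" .
  qed
  moreover have "\<Phi> \<in> Bad P" using Bad_P[OF c] by (simp add: \<Psi>(2))
  ultimately show ?thesis using C by blast
qed

end
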